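(* For a real Banach space $X$ the following are equivalent: (a) $X$ is reflexive and has the Kadec-Klee property; (b) for every nonempty closed convex subset $V$ of $X$, the triplet $(X,V,\mathcal{F}(X))$ has $\mathscr{F}_{cwmc}$-SACP (with respect to the norm topology), where $\mathcal{F}(X)$ is the family of nonempty finite subsets of $X$ and $\mathscr{F}_{cwmc}$ is the class of all convex, weakly strictly monotone, coercive functions $f:\ell_\infty^+(F)\to[0,\infty)$, $F\in\mathcal{F}(X)$.
   Context: $X$ has the Kadec-Klee property if $x,x_n\in S_X$ and $x_n\to x$ weakly imply $x_n\to x$ in norm. For finite $F=\{x_1,\dots,x_N\}$, $\ell_\infty^+(F)$ is identified with $[0,\infty)^N$ with the coordinatewise order. $f$ is monotone if $\varphi_1\le\varphi_2$ implies $f(\varphi_1)\le f(\varphi_2)$; weakly strictly monotone if monotone and $\varphi_1(t)<\varphi_2(t)$ for all $t\in F$ implies $f(\varphi_1)<f(\varphi_2)$; coercive if $f(\varphi)\to\infty$ as $\|\varphi\|_\infty\to\infty$. $r_f(x,F)=f(\|x-x_1\|,\dots,\|x-x_N\|)$, $\mathrm{rad}_V^f(F)=\inf_{v\in V}r_f(v,F)$. $(X,V,\mathfrak{F})$ has $\mathscr{F}$-SACP if for every $F\in\mathfrak{F}$, every $f\in\mathscr{F}$ on $\ell_\infty^+(F)$ and every sequence $(v_n)\subseteq V$ with $r_f(v_n,F)\to\mathrm{rad}_V^f(F)$, $(v_n)$ has a norm-convergent subsequence. *)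

theory Defs
  imports "HOL-Analysis.Analysis"
begin

definition weakly_tendsto :: "(nat \<Rightarrow> 'a::real_normed_vector) \<Rightarrow> 'a \<Rightarrow> bool" where
  "weakly_tendsto xs x \<longleftrightarrow>
     (\<forall>\<phi> :: 'a \<Rightarrow>\<^sub>L real. (\<lambda>n. blinfun_apply \<phi> (xs n)) \<longlonglongrightarrow> blinfun_apply \<phi> x)"

definition reflexive_space :: "'a::real_normed_vector itself \<Rightarrow> bool" where
  "reflexive_space _ \<longleftrightarrow>
     (\<forall>\<Phi> :: ('a \<Rightarrow>\<^sub>L real) \<Rightarrow>\<^sub>L real. \<exists>x::'a. \<forall>\<phi>. blinfun_apply \<Phi> \<phi> = blinfun_apply \<phi> x)"

definition kadec_klee :: "'a::real_normed_vector itself \<Rightarrow> bool" where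
  "kadec_klee _ \<longleftrightarrow>
     (\<forall>(x::'a) xs. norm x = 1 \<and> (\<forall>n. norm (xs n) = 1) \<and> weakly_tendsto xs x \<longrightarrow> xs \<longlonglongrightarrow> x)"

definition linf_plus :: "'a set \<Rightarrow> ('a \<Rightarrow> real) set" where
  "linf_plus F = {\<phi>. (\<forall>t\<in>F. 0 \<le> \<phi> t) \<and> (\<forall>t. t \<notin> F \<longrightarrow> \<phi> t = 0)}"

definition sup_norm_on :: "'a set \<Rightarrow> ('a \<Rightarrow> real) \<Rightarrow> real" where
  "sup_norm_on F \<phi> = Max ((\<lambda>t. \<bar>\<phi> t\<bar>) ` F)"

definition convex_fun_on_linf :: "'a set \<Rightarrow> (('a \<Rightarrow> real) \<Rightarrow> real) \<Rightarrow> bool" where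
  "convex_fun_on_linf F f \<longleftrightarrow>
     (\<forall>\<phi>\<in>linf_plus F. \<forall>\<psi>\<in>linf_plus F. \<forall>u::real. 0 \<le> u \<and> u \<le> 1 \<longrightarrow>
        f (\<lambda>t. u * \<phi> t + (1 - u) * \<psi> t) \<le> u * f \<phi> + (1 - u) * f \<psi>)"

definition monotone_on_linf :: "'a set \<Rightarrow> (('a \<Rightarrow> real) \<Rightarrow> real) \<Rightarrow> bool" where
  "monotone_on_linf F f \<longleftrightarrow>
     (\<forall>\<phi>\<in>linf_plus F. \<forall>\<psi>\<in>linf_plus F. (\<forall>t\<in>F. \<phi> t \<le> \<psi> t) \<longrightarrow> f \<phi> \<le> f \<psi>)"

definition weakly_strictly_monotone_on_linf :: "'a set \<Rightarrow> (('a \<Rightarrow> real) \<Rightarrow> real) \<Rightarrow> bool" where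
  "weakly_strictly_monotone_on_linf F f \<longleftrightarrow> monotone_on_linf F f \<and>
     (\<forall>\<phi>\<in>linf_plus F. \<forall>\<psi>\<in>linf_plus F. (\<forall>t\<in>F. \<phi> t < \<psi> t) \<longrightarrow> f \<phi> < f \<psi>)"

definition coercive_on_linf :: "'a set \<Rightarrow> (('a \<Rightarrow> real) \<Rightarrow> real) \<Rightarrow> bool" where
  "coercive_on_linf F f \<longleftrightarrow>
     (\<forall>M. \<exists>R. \<forall>\<phi>\<in>linf_plus F. sup_norm_on F \<phi> > R \<longrightarrow> f \<phi> > M)"

definition F_cwmc :: "'a set \<Rightarrow> (('a \<Rightarrow> real) \<Rightarrow> real) set" where
  "F_cwmc F = {f. (\<forall>\<phi>\<in>linf_plus F. 0 \<le> f \<phi>) \<and> convex_fun_on_linf F f \<and>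
                  weakly_strictly_monotone_on_linf F f \<and> coercive_on_linf F f}"

definition r_f :: "(('a \<Rightarrow> real) \<Rightarrow> real) \<Rightarrow> 'a::real_normed_vector \<Rightarrow> 'a set \<Rightarrow> real" where
  "r_f f x F = f (\<lambda>t. if t \<in> F then norm (x - t) else 0)"

definition rad_f :: "(('a \<Rightarrow> real) \<Rightarrow> real) \<Rightarrow> 'a::real_normed_vector set \<Rightarrow> 'a set \<Rightarrow> real" where
  "rad_f f V F = (INF v\<in>V. r_f f v F)"

definition SACP :: "('a set \<Rightarrow> (('a \<Rightarrow> real) \<Rightarrow> real) set) \<Rightarrow> 'a::real_normed_vector set \<Rightarrow> 'a set set \<Rightarrow> bool" where
  "SACP Fcls V FF \<longleftrightarrow>
     (\<forall>F\<in>FF. \<forall>f\<in>Fcls F. \<forall>vs::nat \<Rightarrow> 'a. (\<forall>n. vs n \<in> V) \<and>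
        (\<lambda>n. r_f f (vs n) F) \<longlonglongrightarrow> rad_f f V F \<longrightarrow>
        (\<exists>g. strict_mono g \<and> convergent (vs \<circ> g)))"

definition finite_subsets :: "'a set set" where
  "finite_subsets = {F. finite F \<and> F \<noteq> {}}"

end

theory Submission
  imports Defs
begin

text \<open>
  (a) implies (b). By coercivity a minimizing sequence is bounded, so by reflexivity a subsequence
  converges weakly to some \<open>x\<close> in \<open>V\<close>, with all distances to the points of \<open>F\<close> convergent. If every
  limit distance were strictly larger than the distance of \<open>x\<close>, weak strict monotonicity and lower
  semicontinuity of \<open>f\<close> would contradict minimality. So some distance converges to that of \<open>x\<close>, and
  the Kadec-Klee property gives norm convergence.

  (b) implies (a). Applied to the hyperplane \<open>\<phi> = 1\<close> with \<open>norm \<phi> = 1\<close> and to \<open>F = {0}\<close>, condition (b)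
  says that sequences in the unit ball along which \<open>\<phi>\<close> tends to \<open>1\<close> have convergent subsequences. The
  Kadec-Klee property follows at once. For reflexivity, James's theorem is avoided: by
  Bishop and Phelps the elements of the bidual attaining their norm on the dual unit ball are
  dense, and if such a \<open>\<Psi>\<close> attains its norm at \<open>\<phi>\<close>, the compact face \<open>\<phi> = 1\<close> of the unit ball contains a
  point representing \<open>\<Psi>\<close>.
\<close>

section \<open>The Hahn-Banach theorem in Mazur-Orlicz form\<close>

definition sublinear :: "('a::real_vector \<Rightarrow> real) \<Rightarrow> bool" where
  "sublinear p \<longleftrightarrow> (\<forall>x y. p (x + y) \<le> p x + p y) \<and> (\<forall>x c. 0 \<le> c \<longrightarrow> p (c *\<^sub>R x) = c * p x)"

lemma sublinear_add: "sublinear p \<Longrightarrow> p (x + y) \<le> p x + p y"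
  by (simp add: sublinear_def)

lemma sublinear_scale: "sublinear p \<Longrightarrow> 0 \<le> c \<Longrightarrow> p (c *\<^sub>R x) = c * p x"
  by (simp add: sublinear_def)

lemma sublinear_zero: "sublinear p \<Longrightarrow> p 0 = 0"
  using sublinear_scale[of p 0 0] by simp

lemma sublinear_minus: "sublinear p \<Longrightarrow> - p (- x) \<le> p x"
  using sublinear_add[of p x "-x"] sublinear_zero[of p] by simp

text \<open>Applying the one-sided scaling bound to \<open>inverse c\<close> gives the opposite
  inequality, so for functionals defined as infima only upper estimates have to be checked.\<close>

lemma sublinearI:
  assumes "\<And>x y. p (x + y) \<le> p x + p y" and "\<And>x c. 0 < c \<Longrightarrow> p (c *\<^sub>R x) \<le> c * p x"
    and "p 0 = 0"
  shows "sublinear p"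
proof -
  have "p (c *\<^sub>R x) = c * p x" if "0 \<le> c" for x c
  proof (cases "c = 0")
    case False
    with that have c: "0 < c" by simp
    then have "p (inverse c *\<^sub>R c *\<^sub>R x) \<le> inverse c * p (c *\<^sub>R x)"
      by (intro assms(2)) simp
    then have "c * p x \<le> p (c *\<^sub>R x)" using c by (simp add: field_simps)
    with assms(2)[OF c] show ?thesis by (simp add: order_antisym)
  qed (simp add: assms(3))
  then show ?thesis using assms(1) by (simp add: sublinear_def)
qed

lemma sublinear_norm: "0 \<le> e \<Longrightarrow> sublinear (\<lambda>x. e * norm x)"
  by (rule sublinearI) (auto simp: distrib_left[symmetric] intro: mult_left_mono norm_triangle_ineq)

lemma sublinear_below:
  fixes p :: "'a::real_vector \<Rightarrow> real"
  assumes p: "sublinear p" and C: "C \<noteq> {}" and b: "concave_on C b"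
    and le: "\<And>c. c \<in> C \<Longrightarrow> b c \<le> p c"
  obtains q where "sublinear q" "\<And>x. q x \<le> p x" "\<And>c. c \<in> C \<Longrightarrow> q (- c) \<le> - b c"
proof -
  \<comment> \<open>Any linear functional below the infimum \<open>q\<close> lies below \<open>p\<close> (take \<open>l = 0\<close>) and above \<open>b\<close> on \<open>C\<close>
      (take \<open>l = 1\<close>, \<open>x = - c\<close>).\<close>
  define S where "S x = {p (x + l *\<^sub>R c) - l * b c |l c. 0 \<le> l \<and> c \<in> C}" for x
  define q where "q x = Inf (S x)" for x
  obtain c0 where c0: "c0 \<in> C" using C by auto
  \<comment> \<open>The assumption \<open>b c \<le> p c\<close> on \<open>C\<close> enters here: it
    keeps the infimum finite.\<close>
  have lower: "- p (- x) \<le> s" if s_in: "s \<in> S x" for x s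
  proof -
    obtain l c where l: "0 \<le> l" and c: "c \<in> C" and s: "s = p (x + l *\<^sub>R c) - l * b c"
      using s_in by (auto simp: S_def)
    have "p (l *\<^sub>R c) \<le> p (x + l *\<^sub>R c) + p (- x)"
      using sublinear_add[OF p, of "x + l *\<^sub>R c" "- x"] by simp
    moreover have "l * b c \<le> p (l *\<^sub>R c)"
      using l le[OF c] by (simp add: sublinear_scale[OF p] mult_left_mono)
    ultimately show ?thesis using s by simp
  qed
  have bdd: "bdd_below (S x)" for x
    using lower by (intro bdd_belowI) auto
  have ne: "S x \<noteq> {}" for x using c0 by (auto simp: S_def)
  have qle: "q x \<le> p (x + l *\<^sub>R c) - l * b c" if "0 \<le> l" "c \<in> C" for x l c
    unfolding q_def using that by (intro cInf_lower bdd) (auto simp: S_def)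
  have qge: "a \<le> q x" if "\<And>l c. 0 \<le> l \<Longrightarrow> c \<in> C \<Longrightarrow> a \<le> p (x + l *\<^sub>R c) - l * b c" for a x
    unfolding q_def using that by (intro cInf_greatest ne) (auto simp: S_def)
  have qp: "q x \<le> p x" for x using qle[of 0 c0 x] c0 by simp
  have "sublinear q"
  proof (rule sublinearI)
    fix x y
    have *: "q (x + y) \<le> (p (x + l *\<^sub>R c) - l * b c) + (p (y + m *\<^sub>R d) - m * b d)"
      if l: "0 \<le> l" and c: "c \<in> C" and m: "0 \<le> m" and d: "d \<in> C" for l c m d
    proof (cases "l + m = 0")
      case True
      with l m have "l = 0" "m = 0" by auto
      then show ?thesis using qp[of "x + y"] sublinear_add[OF p, of x y] by simp
    next
      case False
      with l m have lm: "0 < l + m" by auto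
      \<comment> \<open>The two competitors \<open>(l, c)\<close> and \<open>(m, d)\<close> merge
        into \<open>(l + m, e)\<close>, with \<open>e\<close> their weighted mean; concavity of
        \<open>b\<close> controls the subtracted term.\<close>
      define e where "e = (l / (l + m)) *\<^sub>R c + (m / (l + m)) *\<^sub>R d"
      have one: "l / (l + m) + m / (l + m) = 1"
        using lm by (simp add: add_divide_distrib[symmetric])
      have e: "e \<in> C"
        unfolding e_def using concave_on_imp_convex[OF b] c d l m lm one by (intro convexD) auto
      have "l / (l + m) * b c + m / (l + m) * b d \<le> b e"
        using conjunct2[OF b[unfolded concave_on_iff], rule_format, OF c d _ _ one] l m
        by (simp add: e_def)
      then have "(l + m) * (l / (l + m) * b c + m / (l + m) * b d) \<le> (l + m) * b e"
        using lm by (intro mult_left_mono) auto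
      then have be: "l * b c + m * b d \<le> (l + m) * b e"
        using lm by (simp add: distrib_left)
      have "(l + m) *\<^sub>R e = l *\<^sub>R c + m *\<^sub>R d"
        using lm by (simp add: e_def scaleR_add_right)
      then have "x + y + (l + m) *\<^sub>R e = (x + l *\<^sub>R c) + (y + m *\<^sub>R d)"
        by (simp add: algebra_simps)
      then have "p (x + y + (l + m) *\<^sub>R e) \<le> p (x + l *\<^sub>R c) + p (y + m *\<^sub>R d)"
        using sublinear_add[OF p] by metis
      then show ?thesis using qle[of "l + m" e "x + y"] lm e be by simp
    qed
    \<comment> \<open>The infimum is taken over \<open>(l, c)\<close> first, with
      \<open>(m, d)\<close> fixed, and then over \<open>(m, d)\<close>.\<close>
    have "q (x + y) - (p (y + m *\<^sub>R d) - m * b d) \<le> q x" if "0 \<le> m" "d \<in> C" for m d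
      using *[OF _ _ that] by (intro qge) (simp add: algebra_simps)
    then have "q (x + y) - q x \<le> q y"
      by (intro qge) (simp add: algebra_simps)
    then show "q (x + y) \<le> q x + q y" by simp
  next
    fix x and a :: real assume a: "0 < a"
    have "q (a *\<^sub>R x) / a \<le> q x"
    proof (rule qge)
      fix l c assume l: "(0::real) \<le> l" and c: "c \<in> C"
      have "q (a *\<^sub>R x) \<le> p (a *\<^sub>R x + (a * l) *\<^sub>R c) - (a * l) * b c"
        using a l c by (intro qle) auto
      also have "a *\<^sub>R x + (a * l) *\<^sub>R c = a *\<^sub>R (x + l *\<^sub>R c)" by (simp add: scaleR_add_right)
      also have "p \<dots> = a * p (x + l *\<^sub>R c)" using a by (simp add: sublinear_scale[OF p])
      finally show "q (a *\<^sub>R x) / a \<le> p (x + l *\<^sub>R c) - l * b c"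
        using a by (simp add: field_simps)
    qed
    then show "q (a *\<^sub>R x) \<le> a * q x" using a by (simp add: field_simps)
  next
    have "0 \<le> q 0" unfolding q_def
      using lower[of _ 0] sublinear_zero[OF p] by (intro cInf_greatest ne) auto
    then show "q 0 = 0" using qp[of 0] sublinear_zero[OF p] by simp
  qed
  moreover have "q (- c) \<le> - b c" if "c \<in> C" for c
    using qle[of 1 c "- c"] that sublinear_zero[OF p] by simp
  ultimately show ?thesis using that qp by blast
qed

theorem hahn_banach_sublinear:
  fixes p :: "'a::real_vector \<Rightarrow> real"
  assumes p: "sublinear p"
  obtains g where "linear g" "\<And>x. g x \<le> p x"
proof -
  \<comment> \<open>A minimal sublinear functional is linear.\<close>
  define A where "A = {q. sublinear q \<and> q \<le> p}"
  \<comment> \<open>The order is reversed, so the maximal element from Zorn's lemma is a minimal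
    functional.\<close>
  define P :: "('a \<Rightarrow> real) \<Rightarrow> ('a \<Rightarrow> real) \<Rightarrow> bool" where "P = (\<lambda>f g. g \<le> f)"
  have "\<exists>m\<in>A. \<forall>a\<in>A. P m a \<longrightarrow> a = m"
  proof (rule predicate_Zorn)
    show "partial_order_on A (relation_of P A)"
      by (rule partial_order_on_relation_ofI) (auto simp: P_def)
    show "\<exists>u\<in>A. \<forall>a\<in>C. P a u" if C: "C \<in> Chains (relation_of P A)" for C
    proof (cases "C = {}")
      case True
      then show ?thesis using p by (auto simp: A_def)
    next
      case ne: False
      have CA: "C \<subseteq> A" using Chains_relation_of[OF C] .
      have tot: "a \<le> b \<or> b \<le> a" if "a \<in> C" "b \<in> C" for a b
        using C that by (auto simp: Chains_def relation_of_def P_def)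
      have sub: "sublinear a" "a \<le> p" if "a \<in> C" for a using CA that by (auto simp: A_def)
      define u where "u x = (INF a\<in>C. a x)" for x
      have lower: "- p (- x) \<le> a x" if "a \<in> C" for a x
        using sublinear_minus[OF sub(1)[OF that], of x] le_funD[OF sub(2)[OF that], of "- x"] by simp
      have bdd: "bdd_below ((\<lambda>a. a x) ` C)" for x
        using lower by (intro bdd_belowI2)
      have ule: "u x \<le> a x" if "a \<in> C" for a x
        unfolding u_def by (rule cINF_lower[OF bdd that])
      have uge: "y \<le> u x" if "\<And>a. a \<in> C \<Longrightarrow> y \<le> a x" for x y
        unfolding u_def using that by (intro cINF_greatest ne)
      have "sublinear u"
      proof (rule sublinearI)
        fix x y
        have *: "u (x + y) \<le> a x + b y" if ab: "a \<in> C" "b \<in> C" for a b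
        proof -
          \<comment> \<open>An infimum of sublinear functionals is subadditive here because a chain
            has one member below both \<open>a\<close> and \<open>b\<close>.\<close>
          obtain c where c: "c \<in> C" "c \<le> a" "c \<le> b" using tot[OF ab] ab by blast
          have "u (x + y) \<le> c x + c y"
            using ule[OF c(1), of "x + y"] sublinear_add[OF sub(1)[OF c(1)], of x y] by simp
          then show ?thesis using le_funD[OF c(2), of x] le_funD[OF c(3), of y] by simp
        qed
        have "u (x + y) - b y \<le> u x" if "b \<in> C" for b
          using *[OF _ that] by (intro uge) (simp add: algebra_simps)
        then have "u (x + y) - u x \<le> u y"
          by (intro uge) (simp add: algebra_simps)
        then show "u (x + y) \<le> u x + u y" by simp
      next
        fix x and c :: real assume c: "0 < c"
        have "u (c *\<^sub>R x) / c \<le> u x"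
          using c ule[of _ "c *\<^sub>R x"] sublinear_scale[OF sub(1), of _ c x]
          by (intro uge) (simp add: field_simps)
        then show "u (c *\<^sub>R x) \<le> c * u x" using c by (simp add: field_simps)
      next
        obtain a where "a \<in> C" using ne by auto
        then show "u 0 = 0"
          using ule[of a 0] uge[of 0 0] sublinear_zero[OF sub(1)] by force
      qed
      moreover have "u \<le> p"
        using ne ule sub(2) by (fastforce simp: le_fun_def intro: order_trans)
      ultimately show ?thesis using ule by (intro bexI[of _ u]) (auto simp: A_def P_def le_fun_def)
    qed
  qed
  then obtain m where m: "sublinear m" "m \<le> p"
    and min: "\<And>a. sublinear a \<Longrightarrow> a \<le> m \<Longrightarrow> a = m"
    by (force simp: A_def P_def)
  have neg: "m (- c) = - m c" for c
  proof -
    have cc: "concave_on {c} m"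
      by (auto simp: concave_on_iff scaleR_left_distrib[symmetric] distrib_right[symmetric])
    \<comment> \<open>Lowering \<open>m\<close> at the single point \<open>- c\<close> must return
      \<open>m\<close> by minimality; together with \<open>sublinear_minus\<close> this makes
      \<open>m\<close> odd.\<close>
    obtain q where "sublinear q" "\<And>x. q x \<le> m x" and q: "q (- c) \<le> - m c"
      using sublinear_below[OF m(1) _ cc] by auto
    then have "q = m" by (intro min) (auto simp: le_fun_def)
    then show ?thesis using q sublinear_minus[OF m(1), of c] by simp
  qed
  have "linear m"
  proof (rule linearI)
    fix x y
    show "m (x + y) = m x + m y"
      using sublinear_add[OF m(1), of x y] sublinear_add[OF m(1), of "- x" "- y"] neg[of "x + y"]
        neg[of x] neg[of y] by simp
  next
    fix c x
    show "m (c *\<^sub>R x) = c *\<^sub>R m x"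
    proof (cases "0 \<le> c")
      case False
      then show ?thesis
        using sublinear_scale[OF m(1), of "- c" x] neg[of "c *\<^sub>R x"] by simp
    qed (simp add: sublinear_scale[OF m(1)])
  qed
  then show ?thesis using that m(2) by (auto simp: le_fun_def)
qed

text \<open>A linear functional below the \<open>q\<close> of \<open>sublinear_below\<close> works:
  evaluation at \<open>- c\<close> turns the upper bound on \<open>q (- c)\<close> into the lower
  bound on \<open>C\<close>.\<close>

theorem mazur_orlicz:
  fixes p :: "'a::real_vector \<Rightarrow> real"
  assumes "sublinear p" and "C \<noteq> {}" and "concave_on C b" and "\<And>c. c \<in> C \<Longrightarrow> b c \<le> p c"
  obtains g where "linear g" "\<And>x. g x \<le> p x" "\<And>c. c \<in> C \<Longrightarrow> b c \<le> g c"
proof -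
  obtain q where q: "sublinear q" "\<And>x. q x \<le> p x" "\<And>c. c \<in> C \<Longrightarrow> q (- c) \<le> - b c"
    using sublinear_below[OF assms] by blast
  obtain g where g: "linear g" "\<And>x. g x \<le> q x" using hahn_banach_sublinear[OF q(1)] by blast
  have "b c \<le> g c" if "c \<in> C" for c
    using g(2)[of "- c"] q(3)[OF that] linear_neg[OF g(1), of c] by simp
  moreover have "g x \<le> p x" for x using g(2)[of x] q(2)[of x] by simp
  ultimately show ?thesis using that g(1) by blast
qed

section \<open>Bounded functionals: domination, norming and separation\<close>

lemma linear_le_norm_blinfun:
  fixes g :: "'a::real_normed_vector \<Rightarrow> real"
  assumes g: "linear g" "\<And>x. g x \<le> e * norm x" and e: "0 \<le> e"
  obtains \<phi> where "blinfun_apply \<phi> = g" "norm \<phi> \<le> e"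
proof -
  have *: "norm (g x) \<le> norm x * e" for x
    using g(2)[of x] g(2)[of "- x"] linear_neg[OF g(1), of x] by (simp add: mult.commute)
  have "bounded_linear g"
    by (rule bounded_linear_intro[OF linear_add[OF g(1)] linear_scale[OF g(1)] *])
  then have a: "blinfun_apply (Blinfun g) = g" by (rule bounded_linear_Blinfun_apply)
  have "norm (Blinfun g) \<le> e"
    using * by (intro norm_blinfun_bound e) (simp add: a mult.commute)
  then show ?thesis using a that by blast
qed

theorem mazur_orlicz_norm:
  fixes C :: "'a::real_normed_vector set"
  assumes "0 \<le> e" and "C \<noteq> {}" and "concave_on C b" and "\<And>c. c \<in> C \<Longrightarrow> b c \<le> e * norm c"
  obtains \<phi> :: "'a \<Rightarrow>\<^sub>L real" where "norm \<phi> \<le> e" "\<And>c. c \<in> C \<Longrightarrow> b c \<le> \<phi> c"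
proof -
  obtain g where g: "linear g" "\<And>x. g x \<le> e * norm x" "\<And>c. c \<in> C \<Longrightarrow> b c \<le> g c"
    using mazur_orlicz[OF sublinear_norm[OF assms(1)] assms(2-4)] by blast
  obtain \<phi> where "blinfun_apply \<phi> = g" "norm \<phi> \<le> e"
    using linear_le_norm_blinfun[OF g(1,2) assms(1)] by blast
  then show ?thesis using that g(3) by auto
qed

lemma blinfun_le_norm:
  fixes \<phi> :: "'a::real_normed_vector \<Rightarrow>\<^sub>L real"
  shows "\<phi> x \<le> norm \<phi> * norm x"
  using norm_blinfun[of \<phi> x] by simp

text \<open>Mazur-Orlicz on the one-point set \<open>{x}\<close> with \<open>b = norm\<close>. The
  bound \<open>\<le> 1\<close> instead of equality admits the zero space.\<close>

lemma norming_functional: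
  fixes x :: "'a::real_normed_vector"
  obtains \<phi> :: "'a \<Rightarrow>\<^sub>L real" where "norm \<phi> \<le> 1" "\<phi> x = norm x"
proof -
  have "concave_on {x} norm"
    by (auto simp: concave_on_iff scaleR_left_distrib[symmetric] distrib_right[symmetric])
  then obtain \<phi> :: "'a \<Rightarrow>\<^sub>L real" where \<phi>: "norm \<phi> \<le> 1" "norm x \<le> \<phi> x"
    using mazur_orlicz_norm[of 1 "{x}" norm] by auto
  have "\<phi> x \<le> norm x"
    using blinfun_le_norm[of \<phi> x] mult_right_mono[OF \<phi>(1) norm_ge_zero[of x]] by simp
  with \<phi> that show ?thesis by force
qed

text \<open>The translate \<open>V - x\<close> avoids a ball of radius \<open>d\<close> about the
  origin, so the constant \<open>d\<close> lies below the norm on it and Mazur-Orlicz applies with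
  \<open>b = d\<close>.\<close>

lemma blinfun_separation:
  fixes x :: "'a::real_normed_vector"
  assumes "convex V" "closed V" "V \<noteq> {}" "x \<notin> V"
  obtains \<phi> :: "'a \<Rightarrow>\<^sub>L real" and d where "0 < d" "\<And>v. v \<in> V \<Longrightarrow> \<phi> x + d \<le> \<phi> v"
proof -
  obtain d where d: "0 < d" "\<And>v. v \<in> V \<Longrightarrow> d \<le> dist x v"
    using assms(2,4) unfolding closed_def open_contains_ball
    by (metis Compl_iff linorder_not_le mem_ball subsetD)
  let ?C = "(\<lambda>v. v - x) ` V"
  have "convex ?C" using assms(1) by (rule convex_translation_subtract)
  then have conc: "concave_on ?C (\<lambda>_. d)" by (auto simp: concave_on_iff distrib_right[symmetric])
  have le: "d \<le> 1 * norm c" if "c \<in> ?C" for c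
    using that d(2) by (auto simp: dist_norm norm_minus_commute)
  have "?C \<noteq> {}" using assms(3) by simp
  then obtain \<phi> :: "'a \<Rightarrow>\<^sub>L real" where "\<And>c. c \<in> ?C \<Longrightarrow> d \<le> \<phi> c"
    using mazur_orlicz_norm[OF zero_le_one _ conc le] by blast
  then show ?thesis using that[OF d(1), of \<phi>] by (force simp: blinfun.diff_right)
qed

lemma blinfun_eqI_real:
  fixes x y :: "'a::real_normed_vector"
  assumes "\<And>\<phi> :: 'a \<Rightarrow>\<^sub>L real. \<phi> x = \<phi> y"
  shows "x = y"
proof -
  obtain \<phi> :: "'a \<Rightarrow>\<^sub>L real" where "\<phi> (x - y) = norm (x - y)" using norming_functional by blast
  then show ?thesis using assms[of \<phi>] by (simp add: blinfun.diff_right)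
qed

section \<open>Weak sequential compactness in reflexive spaces\<close>

text \<open>Tychonoff's theorem replaces the diagonal argument: the product of the intervals is
  compact, and a countable index type makes the product first countable, so compactness is
  sequential.\<close>

lemma bounded_pointwise_convergent_subsequence:
  fixes f :: "nat \<Rightarrow> 'a::countable \<Rightarrow> real"
  assumes "\<And>n i. \<bar>f n i\<bar> \<le> M i"
  obtains r :: "nat \<Rightarrow> nat" where "strict_mono r" "\<And>i. convergent (\<lambda>n. f (r n) i)"
proof -
  let ?K = "PiE UNIV (\<lambda>i. {- M i..M i})"
  have "compactin (product_topology (\<lambda>_. euclidean) UNIV) ?K"
    by (simp add: compactin_PiE)
  then have K: "seq_compact ?K"
    by (intro compact_imp_seq_compact) (simp add: euclidean_product_topology)
  have "\<forall>n. f n \<in> ?K"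
    using assms by (auto simp: abs_le_iff minus_le_iff)
  then obtain l r where "l \<in> ?K" and r: "strict_mono (r :: nat \<Rightarrow> nat)" and l: "(f \<circ> r) \<longlonglongrightarrow> l"
    by (rule seq_compactE[OF K])
  have "(\<lambda>n. f (r n) i) \<longlonglongrightarrow> l i" for i
  proof -
    have "continuous_on UNIV (\<lambda>g :: 'a \<Rightarrow> real. g i)" by simp
    then have "((\<lambda>g. g i) \<longlongrightarrow> l i) (at l)"
      by (simp only: continuous_on_def) simp
    from tendsto_compose[OF this l] show ?thesis by (simp add: comp_def)
  qed
  then show ?thesis using that[OF r] convergent_def by blast
qed

lemma reflexive_weak_cluster_point:
  fixes v :: "nat \<Rightarrow> 'a::real_normed_vector"
  assumes "reflexive_space TYPE('a)" and bd: "\<And>n. norm (v n) \<le> M"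
  obtains x where "\<And>(\<phi> :: 'a \<Rightarrow>\<^sub>L real) c. (\<forall>\<^sub>F n in sequentially. \<phi> (v n) \<le> c) \<Longrightarrow> \<phi> x \<le> c"
proof -
  \<comment> \<open>The infimum \<open>p \<phi>\<close> is the limit superior of \<open>\<phi> (v n)\<close>; a linear functional below it lies in the
      bidual.\<close>
  define S where "S \<phi> = {c. \<forall>\<^sub>F n in sequentially. blinfun_apply \<phi> (v n) \<le> c}" for \<phi> :: "'a \<Rightarrow>\<^sub>L real"
  define p where "p \<phi> = Inf (S \<phi>)" for \<phi>
  have M: "0 \<le> M" using bd[of 0] norm_ge_zero order_trans by blast
  have abs: "\<bar>\<phi> (v n)\<bar> \<le> M * norm \<phi>" for \<phi> :: "'a \<Rightarrow>\<^sub>L real" and n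
    using norm_blinfun[of \<phi> "v n"] mult_left_mono[OF bd[of n] norm_ge_zero[of \<phi>]]
    by (simp add: mult.commute)
  have in_S: "M * norm \<phi> \<in> S \<phi>" for \<phi>
    using abs[of \<phi>] by (auto simp: S_def abs_le_iff)
  have lower: "- (M * norm \<phi>) \<le> c" if c: "c \<in> S \<phi>" for \<phi> c
  proof -
    obtain n where "\<phi> (v n) \<le> c" using c eventually_happens'[OF sequentially_bot] by (auto simp: S_def)
    then show ?thesis using abs[of \<phi> n] by simp
  qed
  have bdd: "bdd_below (S \<phi>)" for \<phi> using lower by (intro bdd_belowI) auto
  have p_le: "p \<phi> \<le> c" if "c \<in> S \<phi>" for \<phi> c
    unfolding p_def by (rule cInf_lower[OF that bdd])
  have p_ge: "a \<le> p \<phi>" if "\<And>c. c \<in> S \<phi> \<Longrightarrow> a \<le> c" for \<phi> a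
    unfolding p_def using in_S that by (intro cInf_greatest) auto
  have "sublinear p"
  proof (rule sublinearI)
    fix \<phi> \<psi>
    have *: "p (\<phi> + \<psi>) \<le> c + d" if c: "c \<in> S \<phi>" and d: "d \<in> S \<psi>" for c d
    proof (rule p_le)
      have "\<forall>\<^sub>F n in sequentially. \<phi> (v n) \<le> c \<and> \<psi> (v n) \<le> d"
        using c d by (simp add: S_def eventually_conj)
      then have "\<forall>\<^sub>F n in sequentially. (\<phi> + \<psi>) (v n) \<le> c + d"
        by (rule eventually_mono) (simp add: blinfun.add_left)
      then show "c + d \<in> S (\<phi> + \<psi>)" by (simp add: S_def)
    qed
    have "p (\<phi> + \<psi>) - d \<le> p \<phi>" if "d \<in> S \<psi>" for d
      using *[OF _ that] by (intro p_ge) (simp add: algebra_simps)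
    then have "p (\<phi> + \<psi>) - p \<phi> \<le> p \<psi>" by (intro p_ge) (simp add: algebra_simps)
    then show "p (\<phi> + \<psi>) \<le> p \<phi> + p \<psi>" by simp
  next
    fix \<phi> and a :: real assume a: "0 < a"
    have "p (a *\<^sub>R \<phi>) / a \<le> p \<phi>"
    proof (rule p_ge)
      fix c assume "c \<in> S \<phi>"
      then have "a * c \<in> S (a *\<^sub>R \<phi>)" using a by (simp add: S_def blinfun.scaleR_left)
      then show "p (a *\<^sub>R \<phi>) / a \<le> c" using p_le a by (simp add: field_simps)
    qed
    then show "p (a *\<^sub>R \<phi>) \<le> a * p \<phi>" using a by (simp add: field_simps)
  next
    show "p 0 = 0" using p_le[OF in_S, of 0] p_ge[of 0 0] lower[of _ 0] by auto
  qed
  then obtain g where g: "linear g" "\<And>\<phi>. g \<phi> \<le> p \<phi>" using hahn_banach_sublinear by blast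
  have "g \<phi> \<le> M * norm \<phi>" for \<phi> using g(2)[of \<phi>] p_le[OF in_S, of \<phi>] by simp
  then obtain \<Phi> where "blinfun_apply \<Phi> = g" using linear_le_norm_blinfun[OF g(1) _ M] by blast
  \<comment> \<open>Reflexivity turns the bidual element into a point of the space.\<close>
  then obtain x where x: "\<And>\<phi>. g \<phi> = blinfun_apply \<phi> x"
    using assms(1) unfolding reflexive_space_def by metis
  have "\<phi> x \<le> c" if "\<forall>\<^sub>F n in sequentially. \<phi> (v n) \<le> c" for \<phi> :: "'a \<Rightarrow>\<^sub>L real" and c
    using g(2)[of \<phi>] p_le[of c \<phi>] that by (simp add: S_def flip: x)
  then show ?thesis by (rule that)
qed

text \<open>A functional separating \<open>x\<close> from \<open>V\<close> would bound
  \<open>- \<phi>\<close> along the sequence by \<open>- (\<phi> x + d)\<close>, a bound that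
  \<open>x\<close> violates.\<close>

lemma weak_cluster_point_in_closed_convex:
  fixes x :: "'a::real_normed_vector"
  assumes x: "\<And>(\<phi> :: 'a \<Rightarrow>\<^sub>L real) c. (\<forall>\<^sub>F n in sequentially. \<phi> (v n) \<le> c) \<Longrightarrow> \<phi> x \<le> c"
    and V: "convex V" "closed V" and v: "\<And>n. v n \<in> V"
  shows "x \<in> V"
proof (rule ccontr)
  assume xV: "x \<notin> V"
  have ne: "V \<noteq> {}" using v[of 0] by auto
  obtain \<phi> :: "'a \<Rightarrow>\<^sub>L real" and d where d: "0 < d" "\<And>w. w \<in> V \<Longrightarrow> \<phi> x + d \<le> \<phi> w"
    by (rule blinfun_separation[OF V ne xV]) blast
  have "(- \<phi>) (v n) \<le> - (\<phi> x + d)" for n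
    using d(2)[OF v[of n]] by (simp add: blinfun.minus_left)
  then have "(- \<phi>) x \<le> - (\<phi> x + d)" by (intro x always_eventually allI)
  with d(1) show False by (simp add: blinfun.minus_left)
qed

text \<open>\<open>D\<close> is the rational span of the sequence, countable because it is indexed
  by lists of rationals. Density of the rationals makes its closure stable under real
  scalars.\<close>

lemma countable_dense_subset_closed_subspace:
  fixes v :: "nat \<Rightarrow> 'a::real_normed_vector"
  obtains D where "countable D" "subspace (closure D)" "range v \<subseteq> closure D"
proof -
  define comb where "comb qs = (\<Sum>i<length qs. real_of_rat (qs ! i) *\<^sub>R v i)" for qs
  define D where "D = range comb"
  have add: "x + y \<in> D" if xy: "x \<in> D" "y \<in> D" for x y
  proof -
    obtain p q where x: "x = comb p" and y: "y = comb q" using xy by (auto simp: D_def)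
    define n where "n = max (length p) (length q)"
    \<comment> \<open>Padding with zeros lets lists of different lengths be added
      coordinatewise.\<close>
    define h where "h r i = (if i < length r then r ! i else 0)" for r :: "rat list" and i
    have ext: "comb r = (\<Sum>i<n. real_of_rat (h r i) *\<^sub>R v i)" if "length r \<le> n" for r
      unfolding comb_def h_def using that by (intro sum.mono_neutral_cong_left) auto
    have "x + y = (\<Sum>i<n. real_of_rat (h p i + h q i) *\<^sub>R v i)"
      by (simp add: x y ext n_def sum.distrib[symmetric] scaleR_add_left of_rat_add)
    also have "\<dots> = comb (map (\<lambda>i. h p i + h q i) [0..<n])"
      by (auto simp: comb_def intro!: sum.cong)
    finally have "x + y = comb (map (\<lambda>i. h p i + h q i) [0..<n])" .
    then show ?thesis by (simp add: D_def)
  qed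
  have scale: "real_of_rat q *\<^sub>R x \<in> D" if "x \<in> D" for x q
  proof -
    have "real_of_rat q *\<^sub>R comb r = comb (map ((*) q) r)" for r
      by (simp add: comb_def scaleR_sum_right of_rat_mult)
    with that show ?thesis by (auto simp: D_def)
  qed
  have "subspace (closure D)"
    unfolding subspace_def
  proof (intro conjI ballI allI)
    have "comb [] \<in> D" by (simp add: D_def)
    then show "0 \<in> closure D" using closure_subset by (fastforce simp: comb_def)
  next
    fix x y assume "x \<in> closure D" "y \<in> closure D"
    then obtain a b where "\<And>n. a n \<in> D" "a \<longlonglongrightarrow> x" "\<And>n. b n \<in> D" "b \<longlonglongrightarrow> y"
      unfolding closure_sequential by blast
    then show "x + y \<in> closure D"
      unfolding closure_sequential by (intro exI[of _ "\<lambda>n. a n + b n"]) (auto intro: add tendsto_add)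
  next
    fix c :: real and x assume "x \<in> closure D"
    then obtain a where a: "\<And>n. a n \<in> D" "a \<longlonglongrightarrow> x" unfolding closure_sequential by blast
    have "c \<in> closure \<rat>" by (simp add: Rats_closure_real)
    then obtain q where q: "\<And>n. q n \<in> \<rat>" "q \<longlonglongrightarrow> c" unfolding closure_sequential by blast
    have "q n *\<^sub>R a n \<in> D" for n using scale[OF a(1)] q(1) by (metis Rats_cases)
    then show "c *\<^sub>R x \<in> closure D"
      unfolding closure_sequential using tendsto_scaleR[OF q(2) a(2)]
      by (intro exI[of _ "\<lambda>n. q n *\<^sub>R a n"]) auto
  qed
  moreover have "v n \<in> D" for n
  proof -
    have "comb (replicate n 0 @ [1]) = v n"
      by (simp add: comb_def nth_append)
    then show ?thesis unfolding D_def by (metis rangeI)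
  qed
  ultimately show ?thesis
    using that[of D] closure_subset[of D] by (auto simp: D_def)
qed

text \<open>Countably many functionals norming a dense set separate the points of the separable
  subspace \<open>closure D\<close>. Along a subsequence on which all of them converge, cluster
  points of further subsequences share the same values, hence coincide, and this forces weak
  convergence.\<close>

theorem reflexive_weakly_convergent_subsequence:
  fixes v :: "nat \<Rightarrow> 'a::real_normed_vector"
  assumes refl: "reflexive_space TYPE('a)" and bd: "\<And>n. norm (v n) \<le> M"
  obtains x r where "strict_mono (r :: nat \<Rightarrow> nat)" "weakly_tendsto (v \<circ> r) x"
proof -
  obtain D where D: "countable D" "subspace (closure D)" "range v \<subseteq> closure D"
    using countable_dense_subset_closed_subspace[of v] by blast
  then have "closure D \<noteq> {}" by auto
  then have "D \<noteq> {}" by auto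
  define d where "d = from_nat_into D"
  have d: "range d = D" unfolding d_def using D(1) \<open>D \<noteq> {}\<close> by (simp add: range_from_nat_into)
  have "\<exists>\<phi> :: 'a \<Rightarrow>\<^sub>L real. norm \<phi> \<le> 1 \<and> blinfun_apply \<phi> (d i) = norm (d i)" for i
    using norming_functional[of "d i"] by blast
  then obtain N :: "nat \<Rightarrow> 'a \<Rightarrow>\<^sub>L real" where N: "norm (N i) \<le> 1" "N i (d i) = norm (d i)" for i
    by metis
  have N_le: "\<bar>N i x\<bar> \<le> norm x" for i x
    using norm_blinfun[of "N i" x] mult_right_mono[OF N(1)[of i] norm_ge_zero[of x]] by simp
  obtain r :: "nat \<Rightarrow> nat" where r: "strict_mono r" and conv: "\<And>i. convergent (\<lambda>n. N i (v (r n)))"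
    using bounded_pointwise_convergent_subsequence[of "\<lambda>n i. N i (v n)" "\<lambda>_. M"] N_le bd order_trans
    by metis
  obtain L where L: "(\<lambda>n. N i (v (r n))) \<longlonglongrightarrow> L i" for i
    using conv unfolding convergent_def by metis
  \<comment> \<open>If \<open>d i\<close> is close to \<open>x - y\<close>, then \<open>N i\<close>
    norms \<open>d i\<close> but vanishes on \<open>x - y\<close>, so both vectors are
    small.\<close>
  have unique: "x = y" if x: "x \<in> closure D" and y: "y \<in> closure D" and eq: "\<And>i. N i x = N i y" for x y
  proof -
    have z: "x - y \<in> closure D" using subspace_diff[OF D(2) x y] .
    have "norm (x - y) \<le> 0 + e" if e: "0 < e" for e
    proof -
      obtain i where i: "dist (d i) (x - y) < e / 2"
        using z[unfolded closure_approachable] e d by (metis half_gt_zero rangeE)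
      have "norm (d i) = N i (d i - (x - y))"
        using N(2)[of i] eq[of i] by (simp add: blinfun.diff_right)
      also have "\<dots> \<le> norm (d i - (x - y))" using N_le[of i "d i - (x - y)"] by simp
      finally show ?thesis
        using i norm_triangle_ineq4[of "d i" "d i - (x - y)"] by (simp add: dist_norm)
    qed
    then have "norm (x - y) \<le> 0" by (rule field_le_epsilon)
    then show ?thesis by simp
  qed
  have cluster: "\<exists>x \<in> closure D. (\<forall>i. N i x = L i) \<and>
      (\<forall>(\<phi> :: 'a \<Rightarrow>\<^sub>L real) c.
        (\<forall>\<^sub>F n in sequentially. blinfun_apply \<phi> (v (r (s n))) \<le> c) \<longrightarrow> blinfun_apply \<phi> x \<le> c)"
    if s: "strict_mono s" for s :: "nat \<Rightarrow> nat"
  proof -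
    obtain x where x: "\<And>(\<phi> :: 'a \<Rightarrow>\<^sub>L real) c. (\<forall>\<^sub>F n in sequentially. \<phi> (v (r (s n))) \<le> c) \<Longrightarrow> \<phi> x \<le> c"
      using reflexive_weak_cluster_point[OF refl, of "\<lambda>n. v (r (s n))" M] bd by blast
    have "x \<in> closure D"
      using D(3) by (intro weak_cluster_point_in_closed_convex[OF x] subspace_imp_convex D(2)) auto
    moreover have "N i x = L i" for i
    proof -
      have lim: "(\<lambda>n. N i (v (r (s n)))) \<longlonglongrightarrow> L i"
        using LIMSEQ_subseq_LIMSEQ[OF L[of i] s] by (simp add: comp_def)
      have "N i x \<le> L i + e" if "0 < e" for e
        using order_tendstoD(2)[OF lim, of "L i + e"] that
        by (intro x) (auto elim: eventually_mono)
      moreover have "(- N i) x \<le> - L i + e" if "0 < e" for e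
        using order_tendstoD(1)[OF lim, of "L i - e"] that
        by (intro x) (auto elim: eventually_mono simp: blinfun.minus_left)
      ultimately show ?thesis
        using field_le_epsilon[of "N i x" "L i"] field_le_epsilon[of "(- N i) x" "- L i"]
        by (simp add: blinfun.minus_left)
    qed
    ultimately show ?thesis using x by blast
  qed
  obtain x where x: "x \<in> closure D" "\<And>i. N i x = L i"
    using cluster[OF strict_mono_id] by auto
  \<comment> \<open>A subsequence violating the bound has a cluster point \<open>y\<close> of its
    own; \<open>unique\<close> gives \<open>y = x\<close>, yet \<open>\<phi> y\<close> is at least
    \<open>\<phi> x + e\<close>. The lower bound follows from \<open>- \<phi>\<close>.\<close>
  have up: "\<forall>\<^sub>F n in sequentially. \<phi> (v (r n)) < \<phi> x + e" if e: "0 < e" for \<phi> :: "'a \<Rightarrow>\<^sub>L real" and e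
  proof (rule ccontr)
    assume "\<not> ?thesis"
    then obtain s :: "nat \<Rightarrow> nat" where s: "strict_mono s" "\<And>n. \<not> \<phi> (v (r (s n))) < \<phi> x + e"
      using not_eventually_sequentiallyD by blast
    obtain y where y: "y \<in> closure D" "\<And>i. N i y = L i"
        "\<And>(\<phi> :: 'a \<Rightarrow>\<^sub>L real) c. (\<forall>\<^sub>F n in sequentially. \<phi> (v (r (s n))) \<le> c) \<Longrightarrow> \<phi> y \<le> c"
      using cluster[OF s(1)] by blast
    have "y = x" using unique[OF y(1) x(1)] x(2) y(2) by simp
    have "(- \<phi>) (v (r (s n))) \<le> - (\<phi> x + e)" for n
      using s(2)[of n] by (simp add: blinfun.minus_left)
    then have "(- \<phi>) y \<le> - (\<phi> x + e)" by (intro y(3) always_eventually allI)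
    with \<open>y = x\<close> e show False by (simp add: blinfun.minus_left)
  qed
  have "weakly_tendsto (v \<circ> r) x"
    unfolding weakly_tendsto_def
  proof (intro allI tendstoI)
    fix \<phi> :: "'a \<Rightarrow>\<^sub>L real" and e :: real assume "0 < e"
    from up[OF this, of \<phi>] up[OF this, of "- \<phi>"]
    show "\<forall>\<^sub>F n in sequentially. dist (\<phi> ((v \<circ> r) n)) (\<phi> x) < e"
      by eventually_elim (simp add: dist_real_def blinfun.minus_left abs_less_iff)
  qed
  then show ?thesis using that r by blast
qed

section \<open>Minimizing sequences in reflexive Kadec-Klee spaces\<close>

lemma weakly_tendsto_diff_const:
  assumes "weakly_tendsto w x"
  shows "weakly_tendsto (\<lambda>n. w n - t) (x - t)"
  using assms unfolding weakly_tendsto_def by (simp add: blinfun.diff_right tendsto_diff)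

lemma weakly_tendsto_subseq:
  fixes x :: "'a::real_normed_vector"
  assumes "weakly_tendsto w x" and "strict_mono s"
  shows "weakly_tendsto (w \<circ> s) x"
  unfolding weakly_tendsto_def comp_def
proof
  fix \<phi> :: "'a \<Rightarrow>\<^sub>L real"
  have "(\<lambda>n. \<phi> (w n)) \<longlonglongrightarrow> \<phi> x" using assms(1) by (simp add: weakly_tendsto_def)
  from LIMSEQ_subseq_LIMSEQ[OF this assms(2)] show "(\<lambda>n. \<phi> (w (s n))) \<longlonglongrightarrow> \<phi> x"
    by (simp add: comp_def)
qed

text \<open>Weak lower semicontinuity of the norm, tested on a functional that norms the
  limit.\<close>

lemma weakly_tendsto_norm_le:
  assumes "weakly_tendsto w x" and "(\<lambda>n. norm (w n)) \<longlonglongrightarrow> a"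
  shows "norm x \<le> a"
proof -
  obtain \<phi> :: "'a \<Rightarrow>\<^sub>L real" where \<phi>: "norm \<phi> \<le> 1" "\<phi> x = norm x" using norming_functional by blast
  have "\<phi> y \<le> norm y" for y
    using blinfun_le_norm[of \<phi> y] mult_right_mono[OF \<phi>(1) norm_ge_zero[of y]] by simp
  moreover have "(\<lambda>n. \<phi> (w n)) \<longlonglongrightarrow> norm x"
    using assms(1) unfolding weakly_tendsto_def \<phi>(2)[symmetric] by blast
  ultimately show ?thesis by (intro LIMSEQ_le[OF _ assms(2)]) auto
qed

lemma weakly_tendsto_closed_convex:
  assumes w: "weakly_tendsto w x" and V: "convex V" "closed V" and "\<And>n. w n \<in> V"
  shows "x \<in> V"
proof (rule weak_cluster_point_in_closed_convex[OF _ V, of w])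
  fix \<phi> :: "'a \<Rightarrow>\<^sub>L real" and c assume "\<forall>\<^sub>F n in sequentially. \<phi> (w n) \<le> c"
  then show "\<phi> x \<le> c"
    using w tendsto_upperbound[of "\<lambda>n. \<phi> (w n)" "\<phi> x" sequentially c]
    unfolding weakly_tendsto_def by simp
qed (fact assms(4))

text \<open>Normalizing moves the sequence to the unit sphere, where the Kadec-Klee property speaks;
  convergence of the norms undoes the scaling.\<close>

lemma kadec_klee_tendsto:
  fixes x :: "'a::real_normed_vector"
  assumes KK: "kadec_klee TYPE('a)" and w: "weakly_tendsto w x"
    and n: "(\<lambda>n. norm (w n)) \<longlonglongrightarrow> norm x"
  shows "w \<longlonglongrightarrow> x"
proof (cases "x = 0")
  case True
  then show ?thesis using n tendsto_norm_zero_cancel[of w sequentially] by simp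
next
  case False
  \<comment> \<open>The default \<open>sgn x\<close> keeps every term on the sphere; it occurs only
    finitely often, since the norms tend to \<open>norm x > 0\<close>.\<close>
  define y where "y n = (if w n = 0 then sgn x else sgn (w n))" for n
  have "weakly_tendsto y (sgn x)"
    unfolding weakly_tendsto_def
  proof
    fix \<phi> :: "'a \<Rightarrow>\<^sub>L real"
    have "(\<lambda>n. \<phi> (w n)) \<longlonglongrightarrow> \<phi> x" using w by (simp add: weakly_tendsto_def)
    then have "(\<lambda>n. inverse (norm (w n)) * \<phi> (w n)) \<longlonglongrightarrow> inverse (norm x) * \<phi> x"
      using tendsto_mult[OF tendsto_inverse[OF n]] False by simp
    moreover have "\<forall>\<^sub>F n in sequentially. 0 < norm (w n)"
      using order_tendstoD(1)[OF n, of 0] False by simp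
    then have "\<forall>\<^sub>F n in sequentially. inverse (norm (w n)) * \<phi> (w n) = \<phi> (y n)"
      by (rule eventually_mono) (simp add: y_def sgn_div_norm blinfun.scaleR_right)
    ultimately show "(\<lambda>n. \<phi> (y n)) \<longlonglongrightarrow> \<phi> (sgn x)"
      by (simp add: sgn_div_norm blinfun.scaleR_right tendsto_cong)
  qed
  moreover have "norm (y n) = 1" "norm (sgn x) = 1" for n
    using False by (simp_all add: y_def norm_sgn)
  ultimately have "y \<longlonglongrightarrow> sgn x" using KK unfolding kadec_klee_def by blast
  then have "(\<lambda>n. norm (w n) *\<^sub>R y n) \<longlonglongrightarrow> norm x *\<^sub>R sgn x" using n by (rule tendsto_scaleR[rotated])
  moreover have "(\<lambda>n. norm (w n) *\<^sub>R y n) = w" by (auto simp: y_def sgn_div_norm)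
  moreover have "norm x *\<^sub>R sgn x = x" using False by (simp add: sgn_div_norm)
  ultimately show ?thesis by simp
qed

text \<open>A monotone convex function on the closed orthant is lower semicontinuous even at boundary
  points, because there it is the limit of its values along the ray from the origin.\<close>

lemma F_cwmc_lower_semicontinuous:
  assumes F: "finite F" and f: "f \<in> F_cwmc F"
    and mem: "\<psi> \<in> linf_plus F" "\<And>n. \<psi>s n \<in> linf_plus F"
    and lim: "\<And>t. t \<in> F \<Longrightarrow> (\<lambda>n. \<psi>s n t) \<longlonglongrightarrow> \<psi> t" and flim: "(\<lambda>n. f (\<psi>s n)) \<longlonglongrightarrow> c"
  shows "f \<psi> \<le> c"
proof -
  have mono: "f \<phi>1 \<le> f \<phi>2"
    if "\<phi>1 \<in> linf_plus F" "\<phi>2 \<in> linf_plus F" "\<And>t. t \<in> F \<Longrightarrow> \<phi>1 t \<le> \<phi>2 t" for \<phi>1 \<phi>2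
    using f that
    unfolding F_cwmc_def weakly_strictly_monotone_on_linf_def monotone_on_linf_def by blast
  have scale: "(\<lambda>t. a * \<psi> t) \<in> linf_plus F" if "0 \<le> a" for a
    using mem(1) that by (auto simp: linf_plus_def)
  \<comment> \<open>Shrinking by \<open>a < 1\<close> leaves room in each coordinate where
    \<open>\<psi>\<close> is positive; the others are covered by nonnegativity. Monotonicity of
    \<open>f\<close> then applies.\<close>
  have below: "f (\<lambda>t. a * \<psi> t) \<le> c" if a: "0 < a" "a < 1" for a
  proof -
    have "\<forall>\<^sub>F n in sequentially. a * \<psi> t \<le> \<psi>s n t" if t: "t \<in> F" for t
    proof (cases "\<psi> t = 0")
      case True
      then show ?thesis using mem(2) t by (simp add: linf_plus_def)
    next
      case False
      then have "a * \<psi> t < \<psi> t" using mem(1) a t by (force simp: linf_plus_def)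
      from order_tendstoD(1)[OF lim[OF t] this] show ?thesis by (rule eventually_mono) simp
    qed
    then have "\<forall>\<^sub>F n in sequentially. \<forall>t\<in>F. a * \<psi> t \<le> \<psi>s n t"
      by (simp add: eventually_ball_finite[OF F])
    then have "\<forall>\<^sub>F n in sequentially. f (\<lambda>t. a * \<psi> t) \<le> f (\<psi>s n)"
      by (rule eventually_mono) (use mono scale mem(2) a in auto)
    then show ?thesis using tendsto_lowerbound[OF flim] by simp
  qed
  define B where "B = f (\<lambda>t. 2 * \<psi> t)"
  have conv: "f \<psi> \<le> u * c + (1 - u) * B" if u: "1 / 2 < u" "u < 1" for u
  proof -
    \<comment> \<open>Chosen so that \<open>u * a + (1 - u) * 2 = 1\<close>: then
      \<open>\<psi>\<close> is a convex combination of \<open>a * \<psi>\<close> and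
      \<open>2 * \<psi>\<close>, and \<open>u > 1 / 2\<close> makes \<open>a\<close>
      positive.\<close>
    define a where "a = 2 - 1 / u"
    have a: "0 < a" "a < 1" using u by (auto simp: a_def field_simps)
    have convex: "f (\<lambda>t. u * \<phi>1 t + (1 - u) * \<phi>2 t) \<le> u * f \<phi>1 + (1 - u) * f \<phi>2"
      if "\<phi>1 \<in> linf_plus F" "\<phi>2 \<in> linf_plus F" for \<phi>1 \<phi>2
      using f u that unfolding F_cwmc_def convex_fun_on_linf_def by simp
    have "u * (a * \<psi> t) + (1 - u) * (2 * \<psi> t) = \<psi> t" for t
      using u by (simp add: a_def field_simps)
    then have "f \<psi> = f (\<lambda>t. u * (a * \<psi> t) + (1 - u) * (2 * \<psi> t))" by simp
    also have "\<dots> \<le> u * f (\<lambda>t. a * \<psi> t) + (1 - u) * B"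
      unfolding B_def using a by (intro convex scale) auto
    also have "\<dots> \<le> u * c + (1 - u) * B"
      using below[OF a] u by simp
    finally show ?thesis .
  qed
  \<comment> \<open>The offset 3 keeps all values at least 2/3, inside the range of
    \<open>conv\<close>.\<close>
  let ?u = "\<lambda>n. 1 - inverse (real (n + 3))"
  have "(\<lambda>n. inverse (real (n + 3))) \<longlonglongrightarrow> 0"
    using LIMSEQ_ignore_initial_segment[OF lim_inverse_n, of 3] by simp
  then have "?u \<longlonglongrightarrow> 1 - 0" by (intro tendsto_intros)
  from tendsto_add[OF tendsto_mult_right[OF this, of c]
      tendsto_mult_right[OF tendsto_diff[OF tendsto_const[of 1] this], of B]]
  have "(\<lambda>n. ?u n * c + (1 - ?u n) * B) \<longlonglongrightarrow> c" by simp
  moreover have "f \<psi> \<le> ?u n * c + (1 - ?u n) * B" for n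
    by (rule conv) (auto simp: field_simps)
  ultimately show ?thesis by (intro LIMSEQ_le_const) auto
qed

theorem reflexive_kadec_klee_imp_SACP:
  fixes V :: "'a::real_normed_vector set"
  assumes refl: "reflexive_space TYPE('a)" and KK: "kadec_klee TYPE('a)"
    and V: "closed V" "convex V"
  shows "SACP F_cwmc V finite_subsets"
  unfolding SACP_def
proof (intro ballI allI impI, elim conjE)
  fix F :: "'a set" and f and vs :: "nat \<Rightarrow> 'a"
  assume F: "F \<in> finite_subsets" and f: "f \<in> F_cwmc F" and vs: "\<forall>n. vs n \<in> V"
    and min: "(\<lambda>n. r_f f (vs n) F) \<longlonglongrightarrow> rad_f f V F"
  have fin: "finite F" and ne: "F \<noteq> {}" using F by (auto simp: finite_subsets_def)
  define \<delta> where "\<delta> x = (\<lambda>t. if t \<in> F then norm (x - t) else 0)" for x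
  have \<delta>: "\<delta> x \<in> linf_plus F" for x by (simp add: \<delta>_def linf_plus_def)
  have r_f: "r_f f x F = f (\<delta> x)" for x by (simp add: r_f_def \<delta>_def)
  have rad: "rad_f f V F \<le> f (\<delta> x)" if "x \<in> V" for x
    unfolding rad_f_def r_f[symmetric]
    using f \<delta> that by (intro cINF_lower bdd_belowI2[of _ 0]) (auto simp: F_cwmc_def r_f)
  obtain K where K: "\<And>n. \<bar>r_f f (vs n) F\<bar> \<le> K"
    using convergent_imp_Bseq[OF convergentI[OF min]] unfolding Bseq_def by auto
  obtain R where R: "\<And>\<phi>. \<phi> \<in> linf_plus F \<Longrightarrow> sup_norm_on F \<phi> > R \<Longrightarrow> f \<phi> > K"
    using f unfolding F_cwmc_def coercive_on_linf_def by blast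
  have bd: "norm (vs n - t) \<le> R" if t: "t \<in> F" for n t
  proof -
    have "norm (vs n - t) \<le> sup_norm_on F (\<delta> (vs n))"
      unfolding sup_norm_on_def using fin t by (intro Max_ge) (auto simp: \<delta>_def intro!: image_eqI[of _ _ t])
    also have "\<dots> \<le> R" using R[OF \<delta>[of "vs n"]] K[of n] unfolding r_f by argo
    finally show ?thesis .
  qed
  obtain t0 where t0: "t0 \<in> F" using ne by auto
  have "norm (vs n) \<le> R + norm t0" for n
    using bd[OF t0, of n] norm_triangle_ineq2[of "vs n" t0] by simp
  then obtain x r where r: "strict_mono (r :: nat \<Rightarrow> nat)" and x: "weakly_tendsto (vs \<circ> r) x"
    using reflexive_weakly_convergent_subsequence[OF refl] by blast
  have xV: "x \<in> V" using weakly_tendsto_closed_convex[OF x V(2,1)] vs by simp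
  \<comment> \<open>Enumerating \<open>F\<close> by natural numbers, with repetitions, supplies the
    countable index type for extracting convergent distances.\<close>
  have rF: "range (from_nat_into F) = F" using ne fin by (simp add: range_from_nat_into countable_finite)
  obtain s where s: "strict_mono (s :: nat \<Rightarrow> nat)"
    and conv: "\<And>i. convergent (\<lambda>n. norm (vs (r (s n)) - from_nat_into F i))"
    using bounded_pointwise_convergent_subsequence[of "\<lambda>n i. norm (vs (r n) - from_nat_into F i)" "\<lambda>_. R"]
      bd from_nat_into[OF ne] by auto
  define w where "w = vs \<circ> (r \<circ> s)"
  have w: "weakly_tendsto w x"
    using weakly_tendsto_subseq[OF x s] by (simp add: w_def comp_assoc)
  have "\<forall>t\<in>F. \<exists>a. (\<lambda>n. norm (w n - t)) \<longlonglongrightarrow> a"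
  proof
    fix t assume "t \<in> F"
    then obtain i where "t = from_nat_into F i" using rF by blast
    then show "\<exists>a. (\<lambda>n. norm (w n - t)) \<longlonglongrightarrow> a" using conv[of i] by (simp add: convergent_def w_def)
  qed
  then obtain a where a: "\<And>t. t \<in> F \<Longrightarrow> (\<lambda>n. norm (w n - t)) \<longlonglongrightarrow> a t" by metis
  have le: "norm (x - t) \<le> a t" if "t \<in> F" for t
    using weakly_tendsto_norm_le[OF weakly_tendsto_diff_const[OF w] a[OF that]] .
  define \<alpha> where "\<alpha> t = (if t \<in> F then a t else 0)" for t
  have \<alpha>: "\<alpha> \<in> linf_plus F"
    using order_trans[OF norm_ge_zero le] by (simp add: \<alpha>_def linf_plus_def)
  have "(\<lambda>n. f (\<delta> (w n))) \<longlonglongrightarrow> rad_f f V F"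
    using LIMSEQ_subseq_LIMSEQ[OF min strict_mono_o[OF r s]] by (simp add: r_f w_def comp_def)
  \<comment> \<open>Semicontinuity is used at the vector \<open>\<alpha>\<close> of limit distances,
    which dominates \<open>\<delta> x\<close>; minimality of the radius then rules out strict
    domination in all coordinates.\<close>
  then have "f \<alpha> \<le> rad_f f V F"
    by (rule F_cwmc_lower_semicontinuous[OF fin f \<alpha> \<delta>, rotated]) (simp add: \<delta>_def \<alpha>_def a)
  also have "\<dots> \<le> f (\<delta> x)" by (rule rad[OF xV])
  finally have "f \<alpha> \<le> f (\<delta> x)" .
  moreover have "f (\<delta> x) < f \<alpha>" if "\<forall>t\<in>F. \<delta> x t < \<alpha> t"
    using f \<alpha> \<delta>[of x] that unfolding F_cwmc_def weakly_strictly_monotone_on_linf_def by simp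
  ultimately have "\<not> (\<forall>t\<in>F. \<delta> x t < \<alpha> t)" by (meson linorder_not_le)
  then obtain t where t: "t \<in> F" "a t \<le> norm (x - t)" by (auto simp: \<delta>_def \<alpha>_def not_less)
  then have "(\<lambda>n. norm (w n - t)) \<longlonglongrightarrow> norm (x - t)" using a[OF t(1)] le[OF t(1)] by simp
  then have "(\<lambda>n. w n - t) \<longlonglongrightarrow> x - t"
    by (rule kadec_klee_tendsto[OF KK weakly_tendsto_diff_const[OF w]])
  from tendsto_add[OF this tendsto_const[of t]] have "w \<longlonglongrightarrow> x" by simp
  then show "\<exists>g. strict_mono g \<and> convergent (vs \<circ> g)"
    using strict_mono_o[OF r s] unfolding w_def by (auto intro: convergentI)
qed

section \<open>Compact slices, the Kadec-Klee property and reflexivity\<close>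

text \<open>The geometric form of condition (b) from which both parts of (a) are derived. That
  \<open>\<phi>\<close> attains its norm is a consequence, not an assumption.\<close>

definition slice_compact :: "'a::real_normed_vector itself \<Rightarrow> bool" where
  "slice_compact _ \<longleftrightarrow>
     (\<forall>(\<phi> :: 'a \<Rightarrow>\<^sub>L real) z. norm \<phi> = 1 \<and> (\<forall>n. norm (z n) \<le> 1) \<and> (\<lambda>n. blinfun_apply \<phi> (z n)) \<longlonglongrightarrow> 1 \<longrightarrow>
        (\<exists>g::nat \<Rightarrow> nat. strict_mono g \<and> convergent (z \<circ> g)))"

lemma slice_compactE:
  fixes \<phi> :: "'a::real_normed_vector \<Rightarrow>\<^sub>L real"
  assumes "slice_compact TYPE('a)" "norm \<phi> = 1" "\<And>n. norm (z n) \<le> 1" "(\<lambda>n. \<phi> (z n)) \<longlonglongrightarrow> 1"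
  obtains g l where "strict_mono (g :: nat \<Rightarrow> nat)" "(z \<circ> g) \<longlonglongrightarrow> l"
proof -
  have "\<exists>g::nat \<Rightarrow> nat. strict_mono g \<and> convergent (z \<circ> g)"
    using assms unfolding slice_compact_def by simp
  then show ?thesis using that by (auto simp: convergent_def)
qed

text \<open>With this function and \<open>F = {0}\<close>, \<open>r_f\<close> is the norm, and
  minimizing sequences are those approaching the distance of \<open>V\<close> from the
  origin.\<close>

lemma eval_zero_in_F_cwmc: "(\<lambda>\<psi>. \<psi> 0) \<in> F_cwmc {0}"
  by (auto simp: F_cwmc_def linf_plus_def convex_fun_on_linf_def monotone_on_linf_def
      weakly_strictly_monotone_on_linf_def coercive_on_linf_def sup_norm_on_def)

text \<open>Dividing \<open>z n\<close> by \<open>\<phi> (z n)\<close> gives points of the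
  hyperplane \<open>\<phi> = 1\<close>, which has distance 1 from the origin. Their norms tend to 1,
  so they form a minimizing sequence; multiplying back by scalars tending to 1 preserves
  convergence.\<close>

lemma SACP_imp_slice_compact:
  assumes SACP: "\<And>V :: 'a::real_normed_vector set. V \<noteq> {} \<Longrightarrow> closed V \<Longrightarrow> convex V \<Longrightarrow> SACP F_cwmc V finite_subsets"
  shows "slice_compact TYPE('a)"
  unfolding slice_compact_def
proof (intro allI impI, elim conjE)
  fix \<phi> :: "'a \<Rightarrow>\<^sub>L real" and z
  assume \<phi>: "norm \<phi> = 1" and z: "\<forall>n. norm (z n) \<le> 1" and lim: "(\<lambda>n. \<phi> (z n)) \<longlonglongrightarrow> 1"
  \<comment> \<open>The first \<open>N\<close> terms are dropped to allow division; the shift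
    reappears in the final subsequence.\<close>
  obtain N where N: "\<And>n. n \<ge> N \<Longrightarrow> 0 < \<phi> (z n)"
    using order_tendstoD(1)[OF lim, of 0] by (auto simp: eventually_sequentially)
  define c where "c n = \<phi> (z (n + N))" for n
  have c: "0 < c n" for n using N by (simp add: c_def)
  have c_lim: "c \<longlonglongrightarrow> 1" unfolding c_def using lim by (rule LIMSEQ_ignore_initial_segment)
  define v where "v n = inverse (c n) *\<^sub>R z (n + N)" for n
  define V where "V = {x. \<phi> x = 1}"
  have v: "v n \<in> V" for n
    using c[of n] by (simp add: v_def V_def blinfun.scaleR_right c_def)
  have "closed V" unfolding V_def by (intro closed_Collect_eq continuous_intros)
  moreover have "convex V"
    by (auto simp: V_def convex_def blinfun.add_right blinfun.scaleR_right)
  moreover have "V \<noteq> {}" using v by blast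
  ultimately have SACP_V: "SACP F_cwmc V finite_subsets" by (intro SACP)
  have r_f: "r_f (\<lambda>\<psi>. \<psi> 0) x {0} = norm x" for x :: 'a by (simp add: r_f_def)
  have ge: "1 \<le> norm x" if "x \<in> V" for x
    using that blinfun_le_norm[of \<phi> x] \<phi> by (simp add: V_def)
  have v_le: "norm (v n) \<le> inverse (c n)" for n
    using c[of n] z by (simp add: v_def mult_left_le)
  have inv: "(\<lambda>n. inverse (c n)) \<longlonglongrightarrow> 1" using tendsto_inverse[OF c_lim] by simp
  have nv: "(\<lambda>n. norm (v n)) \<longlonglongrightarrow> 1"
    by (rule tendsto_sandwich[OF _ _ tendsto_const inv]) (use ge v v_le in auto)
  have rad: "rad_f (\<lambda>\<psi>. \<psi> 0) V {0} = 1"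
    unfolding rad_f_def r_f
  proof (rule antisym)
    show "1 \<le> (INF x\<in>V. norm x)" using ge v by (intro cINF_greatest) auto
    have "(INF x\<in>V. norm x) \<le> norm (v n)" for n
      using v by (intro cINF_lower bdd_belowI2[of _ 0]) auto
    then show "(INF x\<in>V. norm x) \<le> 1" by (intro LIMSEQ_le_const[OF nv]) auto
  qed
  have "{0::'a} \<in> finite_subsets" by (simp add: finite_subsets_def)
  from SACP_V[unfolded SACP_def, rule_format, OF this eval_zero_in_F_cwmc, of v]
  obtain g where g: "strict_mono (g :: nat \<Rightarrow> nat)" "convergent (v \<circ> g)"
    using v nv by (auto simp: rad r_f)
  then obtain y where "(v \<circ> g) \<longlonglongrightarrow> y" by (auto simp: convergent_def)
  with LIMSEQ_subseq_LIMSEQ[OF c_lim g(1)]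
  have "(\<lambda>n. (c \<circ> g) n *\<^sub>R (v \<circ> g) n) \<longlonglongrightarrow> 1 *\<^sub>R y" by (rule tendsto_scaleR)
  moreover have "(c \<circ> g) n *\<^sub>R (v \<circ> g) n = z (g n + N)" for n
    using c[of "g n"] by (simp add: v_def)
  ultimately have "convergent (z \<circ> (\<lambda>n. g n + N))" by (auto simp: convergent_def comp_def)
  moreover have "strict_mono (\<lambda>n. g n + N)" using g(1) by (simp add: strict_mono_def)
  ultimately show "\<exists>g::nat \<Rightarrow> nat. strict_mono g \<and> convergent (z \<circ> g)" by blast
qed

text \<open>A functional norming \<open>x\<close> tends to 1 along the sequence, so each subsequence
  has a norm-convergent further subsequence, whose limit must be the weak limit
  \<open>x\<close>.\<close>

lemma slice_compact_imp_kadec_klee: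
  assumes P: "slice_compact TYPE('a::real_normed_vector)"
  shows "kadec_klee TYPE('a)"
  unfolding kadec_klee_def
proof (intro allI impI, elim conjE)
  fix x :: 'a and w
  assume x: "norm x = 1" and w: "\<forall>n. norm (w n) = 1" and weak: "weakly_tendsto w x"
  obtain \<phi> :: "'a \<Rightarrow>\<^sub>L real" where \<phi>: "norm \<phi> \<le> 1" "\<phi> x = norm x" using norming_functional by blast
  have n\<phi>: "norm \<phi> = 1" using blinfun_le_norm[of \<phi> x] \<phi> x by simp
  show "w \<longlonglongrightarrow> x"
  proof (rule ccontr)
    assume "\<not> w \<longlonglongrightarrow> x"
    then obtain e where e: "0 < e" "\<not> (\<forall>\<^sub>F n in sequentially. dist (w n) x < e)"
      by (auto simp: tendsto_iff)
    then obtain s :: "nat \<Rightarrow> nat" where s: "strict_mono s" "\<And>n. \<not> dist (w (s n)) x < e"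
      using not_eventually_sequentiallyD by blast
    have ws: "weakly_tendsto (w \<circ> s) x" by (rule weakly_tendsto_subseq[OF weak s(1)])
    then have "(\<lambda>n. \<phi> ((w \<circ> s) n)) \<longlonglongrightarrow> 1"
      using \<phi>(2) x unfolding weakly_tendsto_def by metis
    then obtain g l where g: "strict_mono (g :: nat \<Rightarrow> nat)" and l: "((w \<circ> s) \<circ> g) \<longlonglongrightarrow> l"
      using slice_compactE[OF P n\<phi>, of "w \<circ> s"] w by auto
    have "\<psi> l = \<psi> x" for \<psi> :: "'a \<Rightarrow>\<^sub>L real"
    proof (rule LIMSEQ_unique)
      show "(\<lambda>n. \<psi> (((w \<circ> s) \<circ> g) n)) \<longlonglongrightarrow> \<psi> l" using l by (intro tendsto_intros)
      show "(\<lambda>n. \<psi> (((w \<circ> s) \<circ> g) n)) \<longlonglongrightarrow> \<psi> x"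
        using weakly_tendsto_subseq[OF ws g] by (simp add: weakly_tendsto_def)
    qed
    then have "l = x" by (rule blinfun_eqI_real)
    with l e(1) have "\<forall>\<^sub>F n in sequentially. dist (((w \<circ> s) \<circ> g) n) x < e" by (simp add: tendsto_iff)
    then show False using s(2) by simp
  qed
qed

section \<open>Norm-attaining elements of the bidual\<close>

lemma blinfun_norm_approx:
  fixes \<eta> :: "'a::real_normed_vector \<Rightarrow>\<^sub>L real"
  assumes e: "0 < e"
  obtains z where "norm z \<le> 1" "norm \<eta> - e \<le> \<eta> z"
proof (rule ccontr)
  assume "\<not> thesis"
  with that have lt: "\<eta> z < norm \<eta> - e" if "norm z \<le> 1" for z using that by force
  have "norm \<eta> \<le> norm \<eta> - e"
  proof (rule norm_blinfun_bound)
    show "0 \<le> norm \<eta> - e" using lt[of 0] by simp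
    show "norm (\<eta> x) \<le> (norm \<eta> - e) * norm x" for x
    proof (cases "x = 0")
      case False
      have "\<eta> (sgn x) < norm \<eta> - e" "\<eta> (- sgn x) < norm \<eta> - e" by (intro lt; simp add: norm_sgn)+
      then have "\<bar>\<eta> (sgn x)\<bar> \<le> norm \<eta> - e" by (simp add: blinfun.minus_right abs_le_iff)
      then have "\<bar>\<eta> (sgn x)\<bar> * norm x \<le> (norm \<eta> - e) * norm x" by (intro mult_right_mono) auto
      moreover have "\<bar>\<eta> (sgn x)\<bar> * norm x = \<bar>\<eta> x\<bar>"
        using False by (simp add: sgn_div_norm blinfun.scaleR_right abs_mult)
      ultimately show ?thesis by simp
    qed simp
  qed
  with e show False by simp
qed

text \<open>The face \<open>K\<close> of the unit ball is compact. Each single value of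
  \<open>\<Psi>\<close> is dominated on \<open>K\<close>; convexity of \<open>K\<close> upgrades
  this to agreement on finitely many functionals, and the finite intersection property to all of
  them.\<close>

theorem norm_attaining_bidual_is_evaluation:
  fixes \<Psi> :: "('a::real_normed_vector \<Rightarrow>\<^sub>L real) \<Rightarrow>\<^sub>L real"
  assumes P: "slice_compact TYPE('a)" and \<Psi>: "norm \<Psi> \<le> 1" and \<phi>: "norm \<phi> \<le> 1" and att: "\<Psi> \<phi> = 1"
  obtains x where "\<And>\<psi>. \<Psi> \<psi> = blinfun_apply \<psi> x"
proof -
  have \<Psi>_le: "\<Psi> \<eta> \<le> norm \<eta>" for \<eta>
    using blinfun_le_norm[of \<Psi> \<eta>] mult_right_mono[OF \<Psi> norm_ge_zero[of \<eta>]] by simp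
  have n\<phi>: "norm \<phi> = 1" using \<Psi>_le[of \<phi>] \<phi> att by simp
  define K where "K = {x. norm x \<le> 1 \<and> \<phi> x = 1}"
  have clK: "closed K"
    unfolding K_def by (intro closed_Collect_conj closed_Collect_le closed_Collect_eq continuous_intros)
  have "seq_compact K"
  proof (rule seq_compactI)
    fix f :: "nat \<Rightarrow> 'a" assume f: "\<forall>n. f n \<in> K"
    have "(\<lambda>n. \<phi> (f n)) \<longlonglongrightarrow> 1" using f by (simp add: K_def)
    moreover have "norm (f n) \<le> 1" for n using f by (simp add: K_def)
    ultimately obtain g l where g: "strict_mono (g :: nat \<Rightarrow> nat)" "(f \<circ> g) \<longlonglongrightarrow> l"
      using slice_compactE[OF P n\<phi>, of f] by blast
    moreover have "l \<in> K" by (rule closed_sequentially[OF clK _ g(2)]) (simp add: f)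
    ultimately show "\<exists>l\<in>K. \<exists>r. strict_mono r \<and> (f \<circ> r) \<longlonglongrightarrow> l" by blast
  qed
  then have K: "compact K" by (simp add: compact_eq_seq_compact_metric)
  have key: "\<exists>x\<in>K. \<Psi> \<psi> \<le> blinfun_apply \<psi> x" for \<psi>
  proof -
    \<comment> \<open>Almost norming points of \<open>\<phi> + t \<psi>\<close>, with \<open>t\<close> tending to \<open>0\<close> and error \<open>t\<^sup>2\<close>, accumulate in \<open>K\<close>.\<close>
    define t where "t n = inverse (real (Suc n))" for n
    have t: "0 < t n" for n by (simp add: t_def)
    have t_lim: "t \<longlonglongrightarrow> 0" unfolding t_def by (rule LIMSEQ_inverse_real_of_nat)
    have "\<exists>z. norm z \<le> 1 \<and> norm (\<phi> + t n *\<^sub>R \<psi>) - (t n)\<^sup>2 \<le> blinfun_apply (\<phi> + t n *\<^sub>R \<psi>) z" for n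
      using blinfun_norm_approx[of "(t n)\<^sup>2" "\<phi> + t n *\<^sub>R \<psi>"] t[of n] by (metis zero_less_power)
    then obtain z where z: "norm (z n) \<le> 1"
        "norm (\<phi> + t n *\<^sub>R \<psi>) - (t n)\<^sup>2 \<le> blinfun_apply (\<phi> + t n *\<^sub>R \<psi>) (z n)" for n
      by metis
    have sum: "1 + t n * \<Psi> \<psi> - (t n)\<^sup>2 \<le> \<phi> (z n) + t n * \<psi> (z n)" for n
      using z(2)[of n] \<Psi>_le[of "\<phi> + t n *\<^sub>R \<psi>"] att
      by (simp add: blinfun.add_left blinfun.add_right blinfun.scaleR_left blinfun.scaleR_right)
    have \<phi>z: "\<phi> (z n) \<le> 1" for n
      using blinfun_le_norm[of \<phi> "z n"] z(1)[of n] n\<phi> by simp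
    \<comment> \<open>As \<open>\<phi> (z n) \<le> 1\<close>, the constant 1 in \<open>sum\<close>
      cancels, and dividing by \<open>t n\<close> leaves the error \<open>t n\<close>.\<close>
    have \<psi>z: "\<Psi> \<psi> - t n \<le> \<psi> (z n)" for n
    proof -
      have "t n * (\<Psi> \<psi> - t n) \<le> t n * \<psi> (z n)"
        using sum[of n] \<phi>z[of n] by (simp add: algebra_simps power2_eq_square)
      then show ?thesis using t[of n] by simp
    qed
    have low: "1 + t n * (\<Psi> \<psi> - norm \<psi>) - (t n)\<^sup>2 \<le> \<phi> (z n)" for n
    proof -
      have "\<psi> (z n) \<le> norm \<psi>"
        using blinfun_le_norm[of \<psi> "z n"] mult_left_mono[OF z(1)[of n] norm_ge_zero[of \<psi>]] by simp
      then have "t n * \<psi> (z n) \<le> t n * norm \<psi>" using t[of n] by simp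
      then show ?thesis using sum[of n] by (simp add: right_diff_distrib)
    qed
    have "(\<lambda>n. 1 + t n * (\<Psi> \<psi> - norm \<psi>) - (t n)\<^sup>2) \<longlonglongrightarrow> 1 + 0 * (\<Psi> \<psi> - norm \<psi>) - 0\<^sup>2"
      using t_lim by (intro tendsto_intros)
    then have lower_lim: "(\<lambda>n. 1 + t n * (\<Psi> \<psi> - norm \<psi>) - (t n)\<^sup>2) \<longlonglongrightarrow> 1" by simp
    have \<phi>_lim: "(\<lambda>n. \<phi> (z n)) \<longlonglongrightarrow> 1"
      by (rule tendsto_sandwich[OF _ _ lower_lim tendsto_const]) (use low \<phi>z in auto)
    obtain g x where g: "strict_mono (g :: nat \<Rightarrow> nat)" and x: "(z \<circ> g) \<longlonglongrightarrow> x"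
      using slice_compactE[OF P n\<phi> z(1) \<phi>_lim] by blast
    have "norm x \<le> 1"
      by (rule LIMSEQ_le_const2[OF tendsto_norm[OF x]]) (simp add: z(1))
    moreover have "\<phi> x = 1"
    proof (rule LIMSEQ_unique)
      show "(\<lambda>n. \<phi> ((z \<circ> g) n)) \<longlonglongrightarrow> \<phi> x" using x by (intro tendsto_intros)
      show "(\<lambda>n. \<phi> ((z \<circ> g) n)) \<longlonglongrightarrow> 1"
        using LIMSEQ_subseq_LIMSEQ[OF \<phi>_lim g] by (simp add: comp_def)
    qed
    moreover have "\<Psi> \<psi> \<le> \<psi> x"
    proof (rule LIMSEQ_le)
      have "(\<lambda>n. \<Psi> \<psi> - (t \<circ> g) n) \<longlonglongrightarrow> \<Psi> \<psi> - 0"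
        using LIMSEQ_subseq_LIMSEQ[OF t_lim g] by (intro tendsto_diff tendsto_const)
      then show "(\<lambda>n. \<Psi> \<psi> - (t \<circ> g) n) \<longlonglongrightarrow> \<Psi> \<psi>" by simp
      show "(\<lambda>n. \<psi> ((z \<circ> g) n)) \<longlonglongrightarrow> \<psi> x" using x by (intro tendsto_intros)
      show "\<exists>N. \<forall>n\<ge>N. \<Psi> \<psi> - (t \<circ> g) n \<le> \<psi> ((z \<circ> g) n)" using \<psi>z by simp
    qed
    ultimately show ?thesis by (auto simp: K_def)
  qed
  have finite_agree: "\<exists>x\<in>K. \<forall>\<psi>\<in>A. blinfun_apply \<psi> x = \<Psi> \<psi>" if A: "finite A" for A
  proof -
    \<comment> \<open>First-order optimality at a minimizer of the squared error \<open>h\<close>, combined with \<open>key\<close> for the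
        gradient direction, forces \<open>h = 0\<close>.\<close>
    define h where "h x = (\<Sum>\<psi>\<in>A. (blinfun_apply \<psi> x - \<Psi> \<psi>)\<^sup>2)" for x
    have "K \<noteq> {}" using key by blast
    moreover have "continuous_on K h" unfolding h_def by (intro continuous_intros)
    ultimately obtain x where x: "x \<in> K" and x_min: "\<And>y. y \<in> K \<Longrightarrow> h x \<le> h y"
      using continuous_attains_inf[OF K] by blast
    define \<eta> where "\<eta> = (\<Sum>\<psi>\<in>A. (\<Psi> \<psi> - blinfun_apply \<psi> x) *\<^sub>R \<psi>)"
    obtain y where y: "y \<in> K" "\<Psi> \<eta> \<le> \<eta> y" using key by blast
    define D where "D = \<eta> (y - x)"
    define Q where "Q = (\<Sum>\<psi>\<in>A. (blinfun_apply \<psi> (y - x))\<^sup>2)"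
    have \<eta>_apply: "\<eta> u = (\<Sum>\<psi>\<in>A. (\<Psi> \<psi> - blinfun_apply \<psi> x) * blinfun_apply \<psi> u)" for u
      by (simp add: \<eta>_def blinfun.sum_left blinfun.scaleR_left)
    have DQ: "2 * D \<le> s * Q" if s: "0 < s" "s \<le> 1" for s
    proof -
      have "convex K"
        unfolding K_def convex_def
      proof (clarsimp simp: blinfun.add_right blinfun.scaleR_right)
        fix a b :: 'a and u v :: real
        assume "norm a \<le> 1" "norm b \<le> 1" "0 \<le> u" "0 \<le> v" "u + v = 1"
        then show "norm (u *\<^sub>R a + v *\<^sub>R b) \<le> 1"
          using norm_triangle_ineq[of "u *\<^sub>R a" "v *\<^sub>R b"]
            mult_left_mono[of "norm a" 1 u] mult_left_mono[of "norm b" 1 v] by simp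
      qed
      then have "(1 - s) *\<^sub>R x + s *\<^sub>R y \<in> K" using x y(1) s by (intro convexD) auto
      moreover have "(1 - s) *\<^sub>R x + s *\<^sub>R y = x + s *\<^sub>R (y - x)" by (simp add: algebra_simps)
      ultimately have "h x \<le> h (x + s *\<^sub>R (y - x))" using x_min by simp
      also have "\<dots> = (\<Sum>\<psi>\<in>A. (blinfun_apply \<psi> x - \<Psi> \<psi>)\<^sup>2
          - 2 * s * ((\<Psi> \<psi> - blinfun_apply \<psi> x) * blinfun_apply \<psi> (y - x)) + s\<^sup>2 * (blinfun_apply \<psi> (y - x))\<^sup>2)"
        unfolding h_def blinfun.add_right blinfun.scaleR_right
        by (intro sum.cong refl) (simp add: power2_eq_square algebra_simps)
      also have "\<dots> = h x - 2 * s * D + s\<^sup>2 * Q"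
        by (simp add: h_def D_def Q_def \<eta>_apply sum.distrib sum_subtractf sum_distrib_left)
      finally have "s * (2 * D) \<le> s * (s * Q)" by (simp add: power2_eq_square algebra_simps)
      then show ?thesis using s(1) by simp
    qed
    have "D \<le> 0"
    proof (rule ccontr)
      assume "\<not> D \<le> 0"
      then have D: "0 < D" by simp
      then have Q: "0 < Q" using DQ[of 1] by simp
      \<comment> \<open>With this step length \<open>2 * D \<le> s * Q \<le> D\<close>, impossible
        for positive \<open>D\<close>.\<close>
      define s where "s = min 1 (D / Q)"
      have "s * Q \<le> D / Q * Q" unfolding s_def using Q by (intro mult_right_mono) auto
      moreover have "0 < s" "s \<le> 1" using D Q by (auto simp: s_def)
      ultimately show False using DQ[of s] D Q by simp
    qed
    then have "\<Psi> \<eta> \<le> \<eta> x" using y(2) by (simp add: D_def blinfun.diff_right)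
    \<comment> \<open>The coefficients of \<open>\<eta>\<close> are the residuals at
      \<open>x\<close>, so this difference is \<open>h x\<close> itself.\<close>
    moreover have "\<Psi> \<eta> - \<eta> x = (\<Sum>\<psi>\<in>A. (\<Psi> \<psi> - blinfun_apply \<psi> x)\<^sup>2)"
      unfolding \<eta>_apply
      by (simp add: \<eta>_def blinfun.sum_right blinfun.scaleR_right sum_subtractf[symmetric]
          power2_eq_square right_diff_distrib)
    ultimately have "(\<Sum>\<psi>\<in>A. (\<Psi> \<psi> - blinfun_apply \<psi> x)\<^sup>2) = 0"
      using sum_nonneg[of A "\<lambda>\<psi>. (\<Psi> \<psi> - blinfun_apply \<psi> x)\<^sup>2"] by simp
    then have "\<forall>\<psi>\<in>A. (\<Psi> \<psi> - blinfun_apply \<psi> x)\<^sup>2 = 0"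
      using A by (subst (asm) sum_nonneg_eq_0_iff) auto
    then show ?thesis using x by auto
  qed
  have "K \<inter> (\<Inter>\<psi>\<in>UNIV. {x. blinfun_apply \<psi> x = \<Psi> \<psi>}) \<noteq> {}"
  proof (rule compact_imp_fip_image[OF K])
    show "closed {x. blinfun_apply \<psi> x = \<Psi> \<psi>}" for \<psi>
      by (intro closed_Collect_eq continuous_intros)
    show "K \<inter> (\<Inter>\<psi>\<in>A. {x. blinfun_apply \<psi> x = \<Psi> \<psi>}) \<noteq> {}" if "finite A" for A
      using finite_agree[OF that] by blast
  qed
  then obtain x where "\<forall>\<psi>. blinfun_apply \<psi> x = \<Psi> \<psi>" by auto
  then show ?thesis using that[of x] by simp
qed

section \<open>Ekeland's principle and the Bishop-Phelps theorem\<close>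

text \<open>Ekeland's variational principle. Each \<open>T x\<close> collects the points whose gain
  over \<open>x\<close> is at least \<open>e\<close> times their distance from it. Moving each time
  to a nearly maximal point of \<open>T x\<close> gives nested sets shrinking to one point
  \<open>m\<close>, and a point beating \<open>m\<close> would lie in all of them.\<close>

theorem ekeland_maximum:
  fixes f :: "'b::complete_space \<Rightarrow> real"
  assumes S: "closed S" "S \<noteq> {}" and f: "continuous_on S f" "bdd_above (f ` S)" and e: "0 < e"
  obtains m where "m \<in> S" "\<And>w. w \<in> S \<Longrightarrow> f w \<le> f m + e * dist m w"
proof -
  define T where "T x = {w \<in> S. f x + e * dist x w \<le> f w}" for x
  have TS: "T x \<subseteq> S" for x by (auto simp: T_def)
  have self: "x \<in> T x" if "x \<in> S" for x using that by (simp add: T_def)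
  have T_trans: "T y \<subseteq> T x" if "y \<in> T x" for x y
  proof
    fix w assume w: "w \<in> T y"
    have "e * dist x w \<le> e * dist x y + e * dist y w"
      using e dist_triangle[of x w y] by (simp add: distrib_left[symmetric])
    then show "w \<in> T x" using that w by (simp add: T_def)
  qed
  have step: "\<exists>y. y \<in> S \<and> y \<in> T x \<and> (\<forall>w\<in>T x. f w \<le> f y + d)" if x: "x \<in> S" and d: "0 < d" for x d
  proof -
    have bdd: "bdd_above (f ` T x)" by (rule bdd_above_mono[OF f(2)]) (use TS in blast)
    have "Sup (f ` T x) - d < Sup (f ` T x)" using d by simp
    moreover have "f ` T x \<noteq> {}" using self[OF x] by blast
    ultimately obtain y where y: "y \<in> T x" "Sup (f ` T x) - d < f y"
      using less_cSupD[of "f ` T x"] by blast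
    have "f w \<le> f y + d" if "w \<in> T x" for w
      using cSup_upper[OF imageI[OF that] bdd] y(2) by simp
    then show ?thesis using y(1) TS by blast
  qed
  \<comment> \<open>The factor \<open>e\<close> in the tolerance cancels against that in
    \<open>T\<close>, so distances are bounded by \<open>(1 / 2) ^ n\<close>.\<close>
  have "\<exists>x. \<forall>n. x n \<in> S \<and> (x (Suc n) \<in> T (x n) \<and> (\<forall>w\<in>T (x n). f w \<le> f (x (Suc n)) + e * (1 / 2) ^ n))"
    by (rule dependent_nat_choice) (use S(2) step e in auto)
  then obtain x where xS: "\<And>n. x n \<in> S" and xT: "\<And>n. x (Suc n) \<in> T (x n)"
    and near: "\<And>n w. w \<in> T (x n) \<Longrightarrow> f w \<le> f (x (Suc n)) + e * (1 / 2) ^ n"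
    by blast
  have mono: "T (x m) \<subseteq> T (x n)" if "n \<le> m" for n m
    using lift_Suc_antimono_le[of "\<lambda>n. T (x n)", OF T_trans[OF xT] that] .
  have small: "dist (x (Suc n)) w \<le> (1 / 2) ^ n" if w: "w \<in> T (x (Suc n))" for n w
  proof -
    have "w \<in> T (x n)" using mono[of n "Suc n"] w by auto
    from near[OF this] w have "e * dist (x (Suc n)) w \<le> e * (1 / 2) ^ n" by (simp add: T_def)
    then show ?thesis using e by simp
  qed
  have half: "(\<lambda>n. (1 / 2 :: real) ^ n) \<longlonglongrightarrow> 0" by (intro LIMSEQ_power_zero) simp
  have "Cauchy (\<lambda>n. x (Suc n))"
    unfolding Cauchy_altdef
  proof (intro allI impI)
    fix d :: real assume "0 < d"
    then obtain M where M: "\<And>n. n \<ge> M \<Longrightarrow> (1 / 2 :: real) ^ n < d"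
      using order_tendstoD(2)[OF half] by (auto simp: eventually_sequentially)
    have "dist (x (Suc m)) (x (Suc n)) < d" if "M \<le> m" "m < n" for m n
      using small[of "x (Suc n)" m] mono[of "Suc m" "Suc n"] self[OF xS] M[OF that(1)] that(2) by force
    then show "\<exists>M. \<forall>m\<ge>M. \<forall>n>m. dist (x (Suc m)) (x (Suc n)) < d" by blast
  qed
  then obtain m where m: "(\<lambda>n. x (Suc n)) \<longlonglongrightarrow> m"
    using Cauchy_convergent convergent_def by blast
  have mS: "m \<in> S" by (rule closed_sequentially[OF S(1) _ m]) (simp add: xS)
  have f_lim: "(\<lambda>n. f (x (Suc n))) \<longlonglongrightarrow> f m"
    using continuous_on_tendsto_compose[OF f(1) m mS] xS by simp
  have mT: "m \<in> T (x n)" for n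
  proof -
    have "(\<lambda>k. f (x n) + e * dist (x n) (x (Suc k))) \<longlonglongrightarrow> f (x n) + e * dist (x n) m"
      using m by (intro tendsto_intros)
    moreover have "f (x n) + e * dist (x n) (x (Suc k)) \<le> f (x (Suc k))" if "k \<ge> n" for k
      using mono[of n "Suc k"] self[OF xS[of "Suc k"]] that by (auto simp: T_def)
    ultimately have "f (x n) + e * dist (x n) m \<le> f m"
      using f_lim by (intro LIMSEQ_le[of _ _ "\<lambda>k. f (x (Suc k))"]) auto
    then show ?thesis using mS by (simp add: T_def)
  qed
  have "f w \<le> f m + e * dist m w" if w: "w \<in> S" for w
  proof (rule ccontr)
    assume neg: "\<not> ?thesis"
    then have "w \<in> T (x (Suc n))" for n using T_trans[OF mT[of "Suc n"]] w by (auto simp: T_def)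
    then have "dist (x (Suc n)) w \<le> (1 / 2) ^ n" for n using small by blast
    then have "(\<lambda>n. dist (x (Suc n)) w) \<longlonglongrightarrow> 0"
      by (intro tendsto_sandwich[OF _ _ tendsto_const half]) auto
    then have "(\<lambda>n. x (Suc n)) \<longlonglongrightarrow> w" by (rule iffD2[OF tendsto_dist_iff])
    from LIMSEQ_unique[OF this m] have "w = m" .
    with neg show False by simp
  qed
  then show ?thesis using that mS by blast
qed

text \<open>At the Ekeland point \<open>m\<close> of \<open>\<Psi>\<close> on the unit ball,
  \<open>\<Psi>\<close> lies below \<open>e * norm\<close> on the ball translated by
  \<open>- m\<close>. Mazur-Orlicz inserts a functional \<open>G\<close> of norm at most
  \<open>e\<close> above \<open>\<Psi>\<close> there, so \<open>\<Psi> - G\<close> attains its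
  maximum over the ball at \<open>m\<close>.\<close>

theorem bishop_phelps:
  fixes \<Psi> :: "'b::banach \<Rightarrow>\<^sub>L real"
  assumes e: "0 < e"
  obtains \<Psi>' :: "'b \<Rightarrow>\<^sub>L real" and m where "norm (\<Psi> - \<Psi>') \<le> e" "norm m \<le> 1" "\<Psi>' m = norm \<Psi>'"
proof -
  let ?S = "cball (0::'b) 1"
  have "\<Psi> x \<le> norm \<Psi>" if "x \<in> ?S" for x
    using blinfun_le_norm[of \<Psi> x] mult_left_mono[of "norm x" 1 "norm \<Psi>"] that by simp
  then have "bdd_above (blinfun_apply \<Psi> ` ?S)" by (intro bdd_aboveI2)
  moreover have "continuous_on ?S (blinfun_apply \<Psi>)" by (intro continuous_intros)
  ultimately obtain m where m: "m \<in> ?S" "\<And>w. w \<in> ?S \<Longrightarrow> \<Psi> w \<le> \<Psi> m + e * dist m w"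
    using ekeland_maximum[of ?S "blinfun_apply \<Psi>" e] e by auto
  let ?C = "(\<lambda>w. w - m) ` ?S"
  have "convex ?C" by (intro convex_translation_subtract convex_cball)
  then have conc: "concave_on ?C (blinfun_apply \<Psi>)"
    by (auto simp: concave_on_iff blinfun.add_right blinfun.scaleR_right)
  have le: "\<Psi> c \<le> e * norm c" if c: "c \<in> ?C" for c
  proof -
    obtain w where w: "w \<in> ?S" "c = w - m" using c by blast
    show ?thesis using m(2)[OF w(1)] w(2) by (simp add: blinfun.diff_right dist_norm norm_minus_commute)
  qed
  have ne: "?C \<noteq> {}" using m(1) by blast
  obtain G :: "'b \<Rightarrow>\<^sub>L real" where G: "norm G \<le> e" "\<And>c. c \<in> ?C \<Longrightarrow> \<Psi> c \<le> G c"
    using mazur_orlicz_norm[OF less_imp_le[OF e] ne conc le] by blast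
  define \<Psi>' where "\<Psi>' = \<Psi> - G"
  have max: "\<Psi>' w \<le> \<Psi>' m" if "norm w \<le> 1" for w
    using G(2)[of "w - m"] that by (simp add: \<Psi>'_def blinfun.diff_right blinfun.diff_left)
  have "norm \<Psi>' \<le> \<Psi>' m + d" if d: "0 < d" for d
  proof -
    obtain z where "norm z \<le> 1" "norm \<Psi>' - d \<le> \<Psi>' z" using blinfun_norm_approx[OF d] by blast
    then show ?thesis using max[of z] by simp
  qed
  then have "norm \<Psi>' \<le> \<Psi>' m" by (rule field_le_epsilon)
  moreover have "\<Psi>' m \<le> norm \<Psi>'"
    using blinfun_le_norm[of \<Psi>' m] mult_left_mono[of "norm m" 1 "norm \<Psi>'"] m(1) by simp
  ultimately show ?thesis using that[of \<Psi>' m] G(1) m(1) by (simp add: \<Psi>'_def)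
qed

section \<open>Reflexivity from density of norm-attaining elements\<close>

lemma norm_le_norm_evaluation:
  fixes \<Theta> :: "('a::real_normed_vector \<Rightarrow>\<^sub>L real) \<Rightarrow>\<^sub>L real"
  assumes "\<And>\<psi>. blinfun_apply \<Theta> \<psi> = blinfun_apply \<psi> x"
  shows "norm x \<le> norm \<Theta>"
proof -
  obtain \<phi> :: "'a \<Rightarrow>\<^sub>L real" where \<phi>: "norm \<phi> \<le> 1" "\<phi> x = norm x" using norming_functional by blast
  then show ?thesis
    using blinfun_le_norm[of \<Theta> \<phi>] assms[of \<phi>] mult_left_mono[OF \<phi>(1) norm_ge_zero[of \<Theta>]] by simp
qed

text \<open>Bishop-Phelps in the dual space approximates \<open>\<Phi>\<close> by norm-attaining
  elements, which are evaluations at points \<open>x n\<close>. The norm bound for evaluations makes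
  these points Cauchy, and completeness of the space gives the point representing
  \<open>\<Phi>\<close>.\<close>

theorem slice_compact_imp_reflexive:
  assumes P: "slice_compact TYPE('a::banach)"
  shows "reflexive_space TYPE('a)"
  unfolding reflexive_space_def
proof
  fix \<Phi> :: "('a \<Rightarrow>\<^sub>L real) \<Rightarrow>\<^sub>L real"
  have "\<exists>\<Theta> x. norm (\<Phi> - \<Theta>) \<le> inverse (real (Suc n)) \<and> (\<forall>\<psi>. blinfun_apply \<Theta> \<psi> = blinfun_apply \<psi> (x::'a))" for n
  proof -
    have "0 < inverse (real (Suc n))" by simp
    then obtain \<Theta> \<phi> where \<Theta>: "norm (\<Phi> - \<Theta>) \<le> inverse (real (Suc n))" "norm \<phi> \<le> 1" "\<Theta> \<phi> = norm \<Theta>"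
      using bishop_phelps by blast
    have "\<exists>x::'a. \<forall>\<psi>. blinfun_apply \<Theta> \<psi> = blinfun_apply \<psi> x"
    proof (cases "\<Theta> = 0")
      case True
      then show ?thesis by (intro exI[of _ 0]) simp
    next
      case False
      let ?\<Psi> = "inverse (norm \<Theta>) *\<^sub>R \<Theta>"
      have "norm ?\<Psi> \<le> 1" "?\<Psi> \<phi> = 1" using False \<Theta>(3) by (simp_all add: blinfun.scaleR_left)
      then obtain x where x: "\<And>\<psi>. ?\<Psi> \<psi> = blinfun_apply \<psi> x"
        using norm_attaining_bidual_is_evaluation[OF P _ \<Theta>(2)] by blast
      have "blinfun_apply \<Theta> \<psi> = blinfun_apply \<psi> (norm \<Theta> *\<^sub>R x)" for \<psi>
        using x[of \<psi>] False by (simp add: blinfun.scaleR_left blinfun.scaleR_right field_simps)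
      then show ?thesis by blast
    qed
    then show ?thesis using \<Theta>(1) by blast
  qed
  then obtain \<Theta> and x :: "nat \<Rightarrow> 'a" where near: "\<And>n. norm (\<Phi> - \<Theta> n) \<le> inverse (real (Suc n))"
    and eval: "\<And>n \<psi>. blinfun_apply (\<Theta> n) \<psi> = blinfun_apply \<psi> (x n)"
    by metis
  have "(\<lambda>n. norm (\<Theta> n - \<Phi>)) \<longlonglongrightarrow> 0"
    by (rule tendsto_sandwich[OF _ _ tendsto_const LIMSEQ_inverse_real_of_nat])
      (use near in \<open>auto simp: norm_minus_commute\<close>)
  then have \<Theta>: "\<Theta> \<longlonglongrightarrow> \<Phi>" using LIM_zero_cancel tendsto_norm_zero_iff by blast
  have "norm (x n - x m) \<le> norm (\<Theta> n - \<Theta> m)" for n m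
    by (rule norm_le_norm_evaluation) (simp add: blinfun.diff_left blinfun.diff_right eval)
  then have "Cauchy x"
    using LIMSEQ_imp_Cauchy[OF \<Theta>] unfolding Cauchy_def dist_norm by (meson order_le_less_trans)
  then obtain y where y: "x \<longlonglongrightarrow> y" using Cauchy_convergent convergent_def by blast
  have "\<Phi> \<psi> = \<psi> y" for \<psi>
  proof (rule LIMSEQ_unique)
    show "(\<lambda>n. \<Theta> n \<psi>) \<longlonglongrightarrow> \<Phi> \<psi>" using \<Theta> by (intro tendsto_intros)
    show "(\<lambda>n. \<Theta> n \<psi>) \<longlonglongrightarrow> \<psi> y" unfolding eval using y by (intro tendsto_intros)
  qed
  then show "\<exists>x. \<forall>\<psi>. blinfun_apply \<Phi> \<psi> = blinfun_apply \<psi> x" by blast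
qed

theorem theorem2p6:
  shows "(reflexive_space TYPE('a::banach) \<and> kadec_klee TYPE('a)) \<longleftrightarrow>
    (\<forall>V::'a set. V \<noteq> {} \<and> closed V \<and> convex V \<longrightarrow>
        SACP F_cwmc V finite_subsets)"
proof
  assume "reflexive_space TYPE('a) \<and> kadec_klee TYPE('a)"
  then show "\<forall>V::'a set. V \<noteq> {} \<and> closed V \<and> convex V \<longrightarrow> SACP F_cwmc V finite_subsets"
    using reflexive_kadec_klee_imp_SACP by blast
next
  assume "\<forall>V::'a set. V \<noteq> {} \<and> closed V \<and> convex V \<longrightarrow> SACP F_cwmc V finite_subsets"
  then have "slice_compact TYPE('a)" by (intro SACP_imp_slice_compact) simp
  then show "reflexive_space TYPE('a) \<and> kadec_klee TYPE('a)"
    using slice_compact_imp_reflexive slice_compact_imp_kadec_klee by blast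
qed

end
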